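(* Let $F$ be a finite abelian group. For every integer $n\ge 2$, the pair $(F\wr S_n,\ (F\wr S_{n-2})\times S_2)$ is a strong Gelfand pair.
   Context: All groups are finite and all representations are finite-dimensional over $\mathbb{C}$. For a subgroup $K\leqslant G$, $(G,K)$ is a strong Gelfand pair if $\mathrm{ind}_K^G V$ is multiplicity-free for every irreducible representation $V$ of $K$. $F\wr S_n=F^n\rtimes S_n$, where $S_n$ permutes the coordinates of $F^n$. $(F\wr S_{n-2})\times S_2$ denotes the subgroup of all $(f,\sigma)\in F^n\rtimes S_n$ with $\sigma\in S_{n-2}\times S_2$ (the stabilizer of $\{n-1,n\}$) and $f_{n-1}=f_n=\mathrm{id}_F$; $F\wr S_0$ is the trivial group. *)

theory Defs
  imports
    Complex_Main
    "HOL-Library.Function_Algebras"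
    "HOL-Algebra.Sym_Groups"
    "HOL-Algebra.Product_Groups"
begin

section \<open>Complex representations\<close>

text \<open>
  A representation is carried by a finite-dimensional subspace \<open>V\<close> of an ambient complex vector
  space, namely the type \<open>'v\<close> with scalar multiplication \<open>s\<close>. The ambient space need not be
  finite-dimensional, and the values of \<open>\<rho> g\<close> off \<open>V\<close> are irrelevant.
\<close>

locale complex_rep = group G + vector_space s
  for G (structure) and s :: "complex \<Rightarrow> 'v::ab_group_add \<Rightarrow> 'v" +
  fixes V :: "'v set" and \<rho> :: "'g \<Rightarrow> 'v \<Rightarrow> 'v"
  constrains G :: "('g, 'm) monoid_scheme"
  assumes finite_dim: "\<exists>B. finite B \<and> V = span B"
    and rep_closed: "\<lbrakk>g \<in> carrier G; x \<in> V\<rbrakk> \<Longrightarrow> \<rho> g x \<in> V"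
    and rep_add: "\<lbrakk>g \<in> carrier G; x \<in> V; y \<in> V\<rbrakk> \<Longrightarrow> \<rho> g (x + y) = \<rho> g x + \<rho> g y"
    and rep_scale: "\<lbrakk>g \<in> carrier G; x \<in> V\<rbrakk> \<Longrightarrow> \<rho> g (s c x) = s c (\<rho> g x)"
    and rep_one: "x \<in> V \<Longrightarrow> \<rho> \<one> x = x"
    and rep_mult: "\<lbrakk>g \<in> carrier G; h \<in> carrier G; x \<in> V\<rbrakk> \<Longrightarrow> \<rho> (g \<otimes> h) x = \<rho> g (\<rho> h x)"

locale irreducible_complex_rep = complex_rep +
  assumes nonzero: "V \<noteq> {0}"
    and irreducible:
      "\<lbrakk>subspace W; W \<subseteq> V; \<And>g. g \<in> carrier G \<Longrightarrow> \<rho> g ` W \<subseteq> W\<rbrakk> \<Longrightarrow> W = {0} \<or> W = V"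

definition rep_iso ::
  "('g, 'm) monoid_scheme
    \<Rightarrow> (complex \<Rightarrow> 'v::ab_group_add \<Rightarrow> 'v) \<Rightarrow> 'v set \<Rightarrow> ('g \<Rightarrow> 'v \<Rightarrow> 'v)
    \<Rightarrow> (complex \<Rightarrow> 'w::ab_group_add \<Rightarrow> 'w) \<Rightarrow> 'w set \<Rightarrow> ('g \<Rightarrow> 'w \<Rightarrow> 'w) \<Rightarrow> bool" where
  "rep_iso G s V \<rho> t W \<sigma> \<longleftrightarrow>
    (\<exists>T. bij_betw T V W
       \<and> (\<forall>x\<in>V. \<forall>y\<in>V. T (x + y) = T x + T y)
       \<and> (\<forall>c. \<forall>x\<in>V. T (s c x) = t c (T x))
       \<and> (\<forall>g\<in>carrier G. \<forall>x\<in>V. T (\<rho> g x) = \<sigma> g (T x)))"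

text \<open>
  Multiplicity-free: \<open>V\<close> is the internal direct sum of finitely many irreducible, pairwise
  non-isomorphic subrepresentations. The bijectivity of the summation map expresses that the sum
  is direct and exhausts \<open>V\<close>. Indexing the summands by a set loses nothing, since distinct nonzero
  summands of a direct sum are distinct subspaces.
\<close>

definition multiplicity_free ::
  "('g, 'm) monoid_scheme
    \<Rightarrow> (complex \<Rightarrow> 'v::ab_group_add \<Rightarrow> 'v) \<Rightarrow> 'v set \<Rightarrow> ('g \<Rightarrow> 'v \<Rightarrow> 'v) \<Rightarrow> bool" where
  "multiplicity_free G s V \<rho> \<longleftrightarrow>
    complex_rep G s V \<rho> \<and>
    (\<exists>\<W>. finite \<W>
       \<and> (\<forall>W\<in>\<W>. irreducible_complex_rep G s W \<rho>)
       \<and> bij_betw (\<lambda>w. \<Sum>W\<in>\<W>. w W) (\<Pi>\<^sub>E W\<in>\<W>. W) V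
       \<and> (\<forall>W\<in>\<W>. \<forall>W'\<in>\<W>. W \<noteq> W' \<longrightarrow> \<not> rep_iso G s W \<rho> s W' \<rho>))"


section \<open>Induced representations and strong Gelfand pairs\<close>

text \<open>
  For finite \<open>G\<close>, \<open>ind\<^sub>K\<^sup>G V\<close> is realised as the space of functions \<open>f : G \<rightarrow> V\<close> with
  \<open>f (k x) = \<rho> k (f x)\<close> for \<open>k \<in> K\<close>, with \<open>G\<close> acting by right translation. Functions are set to \<open>0\<close>
  outside \<open>carrier G\<close>, so that they form a subspace of \<open>'g \<Rightarrow> 'v\<close>.
\<close>

definition ind_scale :: "(complex \<Rightarrow> 'v \<Rightarrow> 'v) \<Rightarrow> complex \<Rightarrow> ('g \<Rightarrow> 'v) \<Rightarrow> 'g \<Rightarrow> 'v" where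
  "ind_scale s c f = (\<lambda>x. s c (f x))"

definition ind_space ::
  "('g, 'm) monoid_scheme \<Rightarrow> 'g set \<Rightarrow> 'v::zero set \<Rightarrow> ('g \<Rightarrow> 'v \<Rightarrow> 'v) \<Rightarrow> ('g \<Rightarrow> 'v) set" where
  "ind_space G K V \<rho> =
    {f. (\<forall>x. x \<notin> carrier G \<longrightarrow> f x = 0)
      \<and> (\<forall>x\<in>carrier G. f x \<in> V)
      \<and> (\<forall>k\<in>K. \<forall>x\<in>carrier G. f (k \<otimes>\<^bsub>G\<^esub> x) = \<rho> k (f x))}"

definition ind_action :: "('g, 'm) monoid_scheme \<Rightarrow> 'g \<Rightarrow> ('g \<Rightarrow> 'v::zero) \<Rightarrow> 'g \<Rightarrow> 'v" where
  "ind_action G g f = (\<lambda>x. if x \<in> carrier G then f (x \<otimes>\<^bsub>G\<^esub> g) else 0)"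

text \<open>
  A definition in HOL cannot quantify over all vector spaces, so the type \<open>'v\<close> of vectors of the
  representations of \<open>K\<close> is a parameter. \<open>(G, K)\<close> is a strong Gelfand pair if
  \<open>strong_gelfand_pair TYPE('v) G K\<close> holds for every type \<open>'v\<close>; accordingly, a theorem
  concluding it should leave \<open>'v\<close> a free type variable.
\<close>

definition strong_gelfand_pair ::
  "'v::ab_group_add itself \<Rightarrow> ('g, 'm) monoid_scheme \<Rightarrow> 'g set \<Rightarrow> bool" where
  "strong_gelfand_pair _ G K \<longleftrightarrow>
    group G \<and> finite (carrier G) \<and> subgroup K G \<and>
    (\<forall>(s :: complex \<Rightarrow> 'v \<Rightarrow> 'v) V \<rho>.
       irreducible_complex_rep (G\<lparr>carrier := K\<rparr>) s V \<rho> \<longrightarrow>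
       multiplicity_free G (ind_scale s) (ind_space G K V \<rho>) (ind_action G))"


section \<open>Wreath products with symmetric groups\<close>

definition semidirect_product ::
  "('a, 'm) monoid_scheme \<Rightarrow> ('b, 'n) monoid_scheme \<Rightarrow> ('b \<Rightarrow> 'a \<Rightarrow> 'a) \<Rightarrow> ('a \<times> 'b) monoid" where
  "semidirect_product N H \<phi> =
    \<lparr>carrier = carrier N \<times> carrier H,
     mult = (\<lambda>(a, h) (b, k). (a \<otimes>\<^bsub>N\<^esub> \<phi> h b, h \<otimes>\<^bsub>H\<^esub> k)),
     one = (\<one>\<^bsub>N\<^esub>, \<one>\<^bsub>H\<^esub>)\<rparr>"

text \<open>
  \<open>(\<sigma> \<cdot> f) i = f (\<sigma>\<inverse> i)\<close> is a left action. Since \<open>\<sigma>\<close> fixes every \<open>i \<notin> {1..n}\<close>, the function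
  \<open>f \<circ> \<sigma>\<inverse>\<close> is again extensional on \<open>{1..n}\<close>.
\<close>

definition wreath_sym :: "('a, 'm) monoid_scheme \<Rightarrow> nat \<Rightarrow> ((nat \<Rightarrow> 'a) \<times> (nat \<Rightarrow> nat)) monoid" where
  "wreath_sym F n =
    semidirect_product (product_group {1..n} (\<lambda>_. F)) (sym_group n) (\<lambda>\<sigma> f. f \<circ> inv' \<sigma>)"

definition wreath_sym_times_S2 ::
  "('a, 'm) monoid_scheme \<Rightarrow> nat \<Rightarrow> ((nat \<Rightarrow> 'a) \<times> (nat \<Rightarrow> nat)) set" where
  "wreath_sym_times_S2 F n =
    {(f, \<sigma>). (f, \<sigma>) \<in> carrier (wreath_sym F n)
       \<and> \<sigma> ` {n - 1, n} = {n - 1, n} \<and> f (n - 1) = \<one>\<^bsub>F\<^esub> \<and> f n = \<one>\<^bsub>F\<^esub>}"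

end

(*
  Gelfand's trick. If an anti-automorphism \<theta> of G maps every element to a K-conjugate of itself,
  then convolution of functions invariant under conjugation by K is commutative. For an irreducible
  representation V of K, every G-endomorphism of ind V is left convolution by such a function:
  its kernel is a function from G to End V, and Schur orthogonality recovers an endomorphism E of V
  from the traces of the E \<rho>(k). So the endomorphism algebra of ind V is commutative, which by
  Maschke's theorem makes ind V multiplicity-free.

  For wreath products, \<theta> is transposition of monomial matrices, an anti-automorphism because F is
  abelian. A monomial matrix is a union of cycles with labelled edges, and transposing reverses the
  cycles; reflecting every cycle, with n - 1 and n exchanged when they share one and fixed otherwise,
  and rescaling at the remaining points conjugates the matrix to its transpose.
*)
theory Submission
  imports Defs "HOL-Computational_Algebra.Fundamental_Theorem_Algebra" "HOL-Combinatorics.Orbits"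
    "HOL-Algebra.FiniteProduct"
begin

section \<open>Schur's lemma\<close>

text \<open>Since \<open>V\<close> may have dimension greater than one, endomorphisms of the induced
  representation are given by kernels with values in \<open>End V\<close>, and reversing a product
  of such kernels would also reverse products in \<open>End V\<close>. Scalar functions invariant
  under \<open>K\<close> form one algebra, independent of \<open>V\<close>, that acts on every
  induced representation. This is why a single \<theta> serves all \<open>V\<close>, and why the
  passage from kernels to scalar functions by traces carries the weight on the representation side.

  In the wreath product the obstacle is that the conjugating element must lie in \<open>K\<close>:
  its permutation preserves \<open>{n - 1, n}\<close> and its labels there are trivial. A reflection
  of a cycle is determined by the image of one point, so it can exchange two given points but in
  general cannot fix both. Rescaling is free to normalise the label at one point of each cycle; the
  label at the mirror image of that point is then trivial too, because the walks between the two
  points, forward and backward, meet the same labels. Two points on one cycle can thus be handled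
  together, which is what the factor \<open>S_2\<close> allows.\<close>

context complex_rep
begin

lemma subspace_V: "subspace V"
  using finite_dim subspace_span by blast

text \<open>Linearity is required on \<open>V\<close> only, since a representation is unconstrained
  elsewhere in the ambient space.\<close>

definition linear_endo :: "('v \<Rightarrow> 'v) \<Rightarrow> bool" where
  "linear_endo T \<longleftrightarrow> (\<forall>x\<in>V. T x \<in> V) \<and> (\<forall>x\<in>V. \<forall>y\<in>V. T (x + y) = T x + T y)
    \<and> (\<forall>c. \<forall>x\<in>V. T (s c x) = s c (T x))"

lemma linear_endoD:
  assumes "linear_endo T"
  shows "x \<in> V \<Longrightarrow> T x \<in> V"
    and "x \<in> V \<Longrightarrow> y \<in> V \<Longrightarrow> T (x + y) = T x + T y"
    and "x \<in> V \<Longrightarrow> T (s c x) = s c (T x)"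
  using assms unfolding linear_endo_def by auto

lemma linear_endo_zero:
  assumes "linear_endo T" shows "T 0 = 0"
  using linear_endoD(3)[OF assms, of 0 0] subspace_0[OF subspace_V] by simp

lemma linear_endo_diff:
  assumes "linear_endo T" "x \<in> V" "y \<in> V"
  shows "T (x - y) = T x - T y"
proof -
  have "T (x - y) + T y = T x"
    using linear_endoD(2)[OF assms(1), of "x - y" y] subspace_diff[OF subspace_V] assms by simp
  then show ?thesis by (metis add_diff_cancel_right')
qed

lemma linear_endo_sum:
  assumes T: "linear_endo T" and "\<And>i. i \<in> I \<Longrightarrow> f i \<in> V"
  shows "T (sum f I) = (\<Sum>i\<in>I. T (f i))"
  using assms(2)
proof (induction I rule: infinite_finite_induct)
  case (insert i I)
  then show ?case
    using linear_endoD(2)[OF T, of "f i" "sum f I"] subspace_sum[OF subspace_V, of I f] by simp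
qed (use linear_endo_zero[OF T] in auto)

lemma linear_endo_rep: "g \<in> carrier G \<Longrightarrow> linear_endo (\<rho> g)"
  unfolding linear_endo_def using rep_closed rep_add rep_scale by blast

text \<open>A root \<open>a\<close> of \<open>p\<close> gives \<open>p = (X - a) q\<close>. Either
  \<open>q(T) x\<close> is nonzero, hence an eigenvector for \<open>a\<close>, or \<open>q\<close>
  is an annihilating polynomial of smaller degree.\<close>

lemma eigenvector_if_annihilated:
  assumes T: "linear_endo T" and "x \<in> V" "x \<noteq> 0" "p \<noteq> 0"
    and "(\<Sum>i\<le>degree p. s (coeff p i) ((T ^^ i) x)) = 0"
  shows "\<exists>a y. y \<in> V \<and> y \<noteq> 0 \<and> T y = s a y"
  using assms(4,5)
proof (induction "degree p" arbitrary: p)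
  case 0
  then obtain c where "p = [:c:]" "c \<noteq> 0" by (metis degree_0_id pCons_0_0)
  with 0 \<open>x \<noteq> 0\<close> show ?case by simp
next
  case (Suc d)
  have Tx: "(T ^^ i) x \<in> V" for i
    by (induction i) (use \<open>x \<in> V\<close> linear_endoD(1)[OF T] in auto)
  have "\<not> constant (poly p)"
    using constant_degree Suc.hyps(2) by (metis nat.simps(3))
  then obtain a where "poly p a = 0"
    using fundamental_theorem_of_algebra by blast
  then obtain q where q: "p = [:-a, 1:] * q"
    by (auto simp: poly_eq_0_iff_dvd elim: dvdE)
  have "q \<noteq> 0" using Suc.prems(1) q by auto
  have dq: "degree q = d"
    using Suc.hyps(2) \<open>q \<noteq> 0\<close> unfolding q by (subst (asm) degree_mult_eq) auto
  define y where "y = (\<Sum>i\<le>d. s (coeff q i) ((T ^^ i) x))"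
  have yV: "y \<in> V"
    unfolding y_def using Tx by (intro subspace_sum[OF subspace_V] subspace_scale[OF subspace_V])
  have Ty: "T y = (\<Sum>i\<le>d. s (coeff q i) ((T ^^ Suc i) x))"
    unfolding y_def by (subst linear_endo_sum[OF T])
      (auto intro!: subspace_scale[OF subspace_V] sum.cong linear_endoD(3)[OF T] Tx)
  have c: "coeff p i = (case i of 0 \<Rightarrow> 0 | Suc j \<Rightarrow> coeff q j) - a * coeff q i" for i
    unfolding q by (auto split: nat.splits)
  have "0 = (\<Sum>i\<le>Suc d. s (coeff p i) ((T ^^ i) x))"
    using Suc by simp
  also have "\<dots> = (\<Sum>i\<le>Suc d. s (case i of 0 \<Rightarrow> 0 | Suc j \<Rightarrow> coeff q j) ((T ^^ i) x))
      - (\<Sum>i\<le>Suc d. s a (s (coeff q i) ((T ^^ i) x)))"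
    unfolding c scale_left_diff_distrib sum_subtractf by simp
  also have "(\<Sum>i\<le>Suc d. s (case i of 0 \<Rightarrow> 0 | Suc j \<Rightarrow> coeff q j) ((T ^^ i) x)) = T y"
    unfolding Ty by (subst sum.atMost_Suc_shift) simp
  also have "(\<Sum>i\<le>Suc d. s a (s (coeff q i) ((T ^^ i) x))) = s a y"
    unfolding y_def scale_sum_right[symmetric] using dq by (simp add: coeff_eq_0)
  finally have "T y = s a y" by simp
  show ?case
  proof (cases "y = 0")
    case True
    show ?thesis
      by (rule Suc.hyps(1)[of q]) (use True dq \<open>q \<noteq> 0\<close> y_def in auto)
  qed (use \<open>T y = s a y\<close> yV in blast)
qed

text \<open>The \<open>N + 1\<close> vectors \<open>x, T x, ..., T^N x\<close> lie in a space
  spanned by \<open>N\<close> vectors; the coefficients of a linear relation among them form an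
  annihilating polynomial of \<open>x\<close>.\<close>

lemma eigenvector_exists:
  assumes T: "linear_endo T" and "V \<noteq> {0}"
  shows "\<exists>a y. y \<in> V \<and> y \<noteq> 0 \<and> T y = s a y"
proof -
  obtain B where B: "finite B" "V = span B" using finite_dim by blast
  obtain x where x: "x \<in> V" "x \<noteq> 0"
    using assms(2) subspace_0[OF subspace_V] by blast
  have Tx: "(T ^^ i) x \<in> V" for i
    by (induction i) (use x linear_endoD(1)[OF T] in auto)
  define N where "N = card B"
  have "\<exists>a. (\<exists>i\<le>N. a i \<noteq> 0) \<and> (\<Sum>i\<le>N. s (a i) ((T ^^ i) x)) = 0"
  \<comment> \<open>Dependence is a property of sets of vectors, so a repetition among the powers is
    treated apart: there the relation has coefficients 1 and -1.\<close>
  proof (cases "inj_on (\<lambda>i. (T ^^ i) x) {..N}")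
    case True
    let ?S = "(\<lambda>i. (T ^^ i) x) ` {..N}"
    have "card ?S = Suc N" using card_image[OF True] by simp
    then have "dependent ?S"
      using independent_span_bound[OF B(1), of ?S] Tx B(2) N_def by fastforce
    then obtain u where "(\<exists>v\<in>?S. u v \<noteq> 0)" "(\<Sum>v\<in>?S. s (u v) v) = 0"
      by (auto simp: dependent_finite)
    then show ?thesis
      by (intro exI[of _ "\<lambda>i. u ((T ^^ i) x)"]) (auto simp: sum.reindex[OF True])
  next
    case False
    then obtain i j where ij: "i \<le> N" "j \<le> N" "i \<noteq> j" "(T ^^ i) x = (T ^^ j) x"
      by (auto simp: inj_on_def)
    have "(\<Sum>k\<le>N. s ((if k = i then 1 else 0) - (if k = j then 1 else 0)) ((T ^^ k) x))
        = (\<Sum>k\<le>N. if k = i then (T ^^ k) x else 0) - (\<Sum>k\<le>N. if k = j then (T ^^ k) x else 0)"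
      unfolding scale_left_diff_distrib sum_subtractf
      by (intro arg_cong2[where f = minus] sum.cong) auto
    also have "\<dots> = 0" using ij by simp
    finally show ?thesis
      using ij by (intro exI[of _ "\<lambda>k. (if k = i then 1 else 0) - (if k = j then 1 else 0)"])
        (auto intro!: exI[of _ i])
  qed
  then obtain a where a: "\<exists>i\<le>N. a i \<noteq> 0" "(\<Sum>i\<le>N. s (a i) ((T ^^ i) x)) = 0" by blast
  define p where "p = (\<Sum>i\<le>N. monom (a i) i)"
  have cp: "coeff p i = (if i \<le> N then a i else 0)" for i
    unfolding p_def coeff_sum by simp
  have "p \<noteq> 0" using a(1) cp by (metis coeff_0)
  have "degree p \<le> N" by (rule degree_le) (simp add: cp)
  have "(\<Sum>i\<le>degree p. s (coeff p i) ((T ^^ i) x)) = (\<Sum>i\<le>N. s (coeff p i) ((T ^^ i) x))"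
    by (rule sum.mono_neutral_left) (use \<open>degree p \<le> N\<close> in \<open>auto simp: coeff_eq_0\<close>)
  also have "\<dots> = 0" using a(2) by (simp add: cp)
  finally show ?thesis
    using eigenvector_if_annihilated[OF T x \<open>p \<noteq> 0\<close>] by blast
qed

section \<open>Equivariant endomorphisms and averaging over the group\<close>

definition equivariant_endo :: "('v \<Rightarrow> 'v) \<Rightarrow> bool" where
  "equivariant_endo T \<longleftrightarrow> linear_endo T \<and> (\<forall>g\<in>carrier G. \<forall>x\<in>V. T (\<rho> g x) = \<rho> g (T x))"

lemma rep_inv:
  assumes "g \<in> carrier G" "x \<in> V"
  shows "\<rho> (inv g) (\<rho> g x) = x" "\<rho> g (\<rho> (inv g) x) = x"
  using rep_mult[of "inv g" g x] rep_mult[of g "inv g" x] assms rep_one by auto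

text \<open>Acting by \<open>h\<close> permutes the summands through
  \<open>g \<mapsto> h \<otimes> g\<close>. The sum is left unnormalised: it is applied both to a
  linear projection (Maschke) and to a rank-one map (orthogonality), with different
  constants.\<close>

lemma equivariant_average:
  assumes fin: "finite (carrier G)"
    and add: "\<And>v w. v \<in> V \<Longrightarrow> w \<in> V \<Longrightarrow> L (v + w) = L v + L w"
    and scl: "\<And>c v. v \<in> V \<Longrightarrow> L (s c v) = s c (L v)"
    and cl: "\<And>v. v \<in> V \<Longrightarrow> L v \<in> V"
  shows "equivariant_endo (\<lambda>v. \<Sum>g\<in>carrier G. \<rho> g (L (\<rho> (inv g) v)))"
  unfolding equivariant_endo_def
proof (intro conjI ballI)
  show "linear_endo (\<lambda>v. \<Sum>g\<in>carrier G. \<rho> g (L (\<rho> (inv g) v)))"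
    unfolding linear_endo_def
    by (auto simp: rep_add rep_scale rep_closed add scl cl sum.distrib scale_sum_right
        intro!: subspace_sum[OF subspace_V] sum.cong)
next
  fix h x assume h: "h \<in> carrier G" and x: "x \<in> V"
  have "(\<Sum>g\<in>carrier G. \<rho> g (L (\<rho> (inv g) (\<rho> h x))))
      = (\<Sum>g\<in>carrier G. \<rho> (h \<otimes> g) (L (\<rho> (inv (h \<otimes> g)) (\<rho> h x))))"
    by (rule sum.reindex_bij_witness[of _ "\<lambda>g. h \<otimes> g" "\<lambda>g. inv h \<otimes> g"])
      (use h in \<open>auto simp: m_assoc[symmetric]\<close>)
  also have "\<dots> = (\<Sum>g\<in>carrier G. \<rho> h (\<rho> g (L (\<rho> (inv g) x))))"
    by (rule sum.cong) (use h x in \<open>auto simp: rep_mult rep_closed cl inv_mult_group rep_inv\<close>)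
  also have "\<dots> = \<rho> h (\<Sum>g\<in>carrier G. \<rho> g (L (\<rho> (inv g) x)))"
    by (rule linear_endo_sum[OF linear_endo_rep[OF h], symmetric]) (auto simp: rep_closed cl x)
  finally show "(\<Sum>g\<in>carrier G. \<rho> g (L (\<rho> (inv g) (\<rho> h x))))
      = \<rho> h (\<Sum>g\<in>carrier G. \<rho> g (L (\<rho> (inv g) x)))" .
qed

end

text \<open>An eigenspace of an equivariant map is invariant, and a nonzero one must be all of
  \<open>V\<close>.\<close>

lemma (in irreducible_complex_rep) schur:
  assumes "equivariant_endo T"
  obtains c where "\<And>x. x \<in> V \<Longrightarrow> T x = s c x"
proof -
  have T: "linear_endo T" and eq: "\<And>g x. g \<in> carrier G \<Longrightarrow> x \<in> V \<Longrightarrow> T (\<rho> g x) = \<rho> g (T x)"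
    using assms unfolding equivariant_endo_def by auto
  obtain a y where y: "y \<in> V" "y \<noteq> 0" "T y = s a y"
    using eigenvector_exists[OF T nonzero] by blast
  let ?W = "{x \<in> V. T x = s a x}"
  have "subspace ?W"
    unfolding subspace_def
    by (auto simp: subspace_0[OF subspace_V] subspace_add[OF subspace_V]
        subspace_scale[OF subspace_V] linear_endoD[OF T] linear_endo_zero[OF T]
        scale_right_distrib mult.commute)
  moreover have "\<rho> g ` ?W \<subseteq> ?W" if "g \<in> carrier G" for g
    using that by (auto simp: rep_closed eq rep_scale)
  ultimately have "?W = {0} \<or> ?W = V" using irreducible by blast
  with y have "?W = V" by blast
  then show thesis using that by blast
qed

section \<open>Complete reducibility and orthogonality\<close>

context complex_rep
begin

lemma obtain_basis:
  assumes "subspace W" "W \<subseteq> V"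
  obtains B where "finite B" "independent B" "span B = W" "card B = dim W"
proof -
  obtain B where B: "B \<subseteq> W" "independent B" "W \<subseteq> span B" "card B = dim W"
    using basis_exists by blast
  obtain C where "finite C" "V = span C" using finite_dim by blast
  then have "finite B" using independent_span_bound B assms by blast
  then show thesis using that B span_minimal[OF B(1) assms(1)] by blast
qed

text \<open>Makes dimension a measure for choosing a smallest subrepresentation and for induction on
  complements. The ambient space may be infinite-dimensional, so the argument compares finite bases
  inside \<open>V\<close>.\<close>

lemma dim_less:
  assumes "subspace W" "W \<subseteq> V" "subspace U" "U \<subset> W"
  shows "dim U < dim W"
proof -
  obtain B where B: "finite B" "independent B" "span B = W" "card B = dim W"
    using obtain_basis[OF assms(1,2)] by blast
  obtain C where C: "finite C" "independent C" "span C = U" "card C = dim U"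
    using obtain_basis[OF assms(3)] assms by blast
  obtain x where x: "x \<in> W" "x \<notin> U" using assms by blast
  have "independent (insert x C)" using C x independent_insertI by blast
  moreover have "insert x C \<subseteq> span B"
    using B(3) x C(3) assms(4) span_superset[of C] by blast
  ultimately have "card (insert x C) \<le> card B" using independent_span_bound[OF B(1)] by blast
  moreover have "x \<notin> C" using x C(3) span_superset[of C] by blast
  ultimately show ?thesis using B C by simp
qed

section \<open>Linear forms and traces\<close>

definition linear_form :: "('v \<Rightarrow> complex) \<Rightarrow> bool" where
  "linear_form \<mu> \<longleftrightarrow> (\<forall>x\<in>V. \<forall>y\<in>V. \<mu> (x + y) = \<mu> x + \<mu> y) \<and> (\<forall>c. \<forall>x\<in>V. \<mu> (s c x) = c * \<mu> x)"

lemma linear_formD: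
  assumes "linear_form \<mu>"
  shows "x \<in> V \<Longrightarrow> y \<in> V \<Longrightarrow> \<mu> (x + y) = \<mu> x + \<mu> y"
    and "x \<in> V \<Longrightarrow> \<mu> (s c x) = c * \<mu> x"
  using assms unfolding linear_form_def by auto

lemma linear_form_sum:
  assumes \<mu>: "linear_form \<mu>" and "\<And>i. i \<in> I \<Longrightarrow> f i \<in> V"
  shows "\<mu> (\<Sum>i\<in>I. s (c i) (f i)) = (\<Sum>i\<in>I. c i * \<mu> (f i))"
  using assms(2)
proof (induction I rule: infinite_finite_induct)
  case (insert i I)
  have "(\<Sum>i\<in>I. s (c i) (f i)) \<in> V"
    using insert.prems by (intro subspace_sum[OF subspace_V] subspace_scale[OF subspace_V]) auto
  then show ?case
    using insert linear_formD[OF \<mu>] subspace_scale[OF subspace_V] by simp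
qed (use linear_formD(2)[OF \<mu>, of 0 0] subspace_0[OF subspace_V] in auto)

lemma linear_form_representation:
  assumes "independent B" "span B = V"
  shows "linear_form (\<lambda>v. representation B v b)"
  unfolding linear_form_def using assms by (simp add: representation_add representation_scale)

lemma linear_form_comp: "linear_form \<mu> \<Longrightarrow> linear_endo E \<Longrightarrow> linear_form (\<lambda>v. \<mu> (E v))"
  unfolding linear_form_def linear_endo_def by simp

definition trace_wrt :: "'v set \<Rightarrow> ('v \<Rightarrow> 'v) \<Rightarrow> complex" where
  "trace_wrt B E = (\<Sum>b\<in>B. representation B (E b) b)"

text \<open>In coordinates the trace of a composition is a double sum over \<open>B\<close> that is
  symmetric in the two factors.\<close>

lemma trace_wrt_comp_commute:
  assumes B: "finite B" "independent B" "span B = V"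
    and A: "linear_endo S" and C: "linear_endo T"
  shows "trace_wrt B (\<lambda>v. S (T v)) = trace_wrt B (\<lambda>v. T (S v))"
proof -
  have BV: "b \<in> V" if "b \<in> B" for b using that B span_superset by blast
  have expand: "trace_wrt B (\<lambda>v. S (T v))
      = (\<Sum>b\<in>B. \<Sum>b'\<in>B. representation B (T b) b' * representation B (S b') b)"
    if S: "linear_endo S" and T: "linear_endo T" for S T
    unfolding trace_wrt_def
  proof (rule sum.cong[OF refl])
    fix b assume b: "b \<in> B"
    have Tb: "T b \<in> V" using linear_endoD(1)[OF T BV[OF b]] .
    have "representation B (S (T b)) b
        = representation B (S (\<Sum>b'\<in>B. s (representation B (T b) b') b')) b"
      using sum_representation_eq[of B "T b" B] B Tb by simp
    also have "\<dots> = (\<Sum>b'\<in>B. representation B (T b) b' * representation B (S b') b)"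
      by (rule linear_form_sum[OF linear_form_comp[OF linear_form_representation[OF B(2,3)] S]])
        (rule BV)
    finally show "representation B (S (T b)) b = \<dots>" .
  qed
  show ?thesis
    unfolding expand[OF A C] expand[OF C A] by (subst sum.swap) (simp add: mult.commute)
qed

section \<open>Subrepresentations, Maschke's theorem and decomposition into irreducibles\<close>

definition subrep :: "'v set \<Rightarrow> bool" where
  "subrep W \<longleftrightarrow> subspace W \<and> W \<subseteq> V \<and> (\<forall>g\<in>carrier G. \<rho> g ` W \<subseteq> W)"

lemma subrepD:
  assumes "subrep W"
  shows "subspace W" "W \<subseteq> V" "g \<in> carrier G \<Longrightarrow> w \<in> W \<Longrightarrow> \<rho> g w \<in> W"
  using assms unfolding subrep_def by auto

lemma complex_rep_subrep:
  assumes "subrep W"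
  shows "complex_rep G s W \<rho>"
proof unfold_locales
  show "\<exists>B. finite B \<and> W = span B"
    using obtain_basis subrepD(1,2)[OF assms] by metis
qed (use subrepD(2,3)[OF assms] rep_add rep_scale rep_one rep_mult in \<open>auto simp: subset_iff\<close>)

text \<open>A basis \<open>C\<close> of \<open>W\<close> is extended to a basis \<open>B\<close> of
  \<open>V\<close>, and only the coordinates belonging to \<open>C\<close> are kept.\<close>

lemma linear_projection:
  assumes W: "subspace W" "W \<subseteq> V"
  obtains p where "\<And>v w. v \<in> V \<Longrightarrow> w \<in> V \<Longrightarrow> p (v + w) = p v + p w"
    "\<And>c v. v \<in> V \<Longrightarrow> p (s c v) = s c (p v)"
    "\<And>v. v \<in> V \<Longrightarrow> p v \<in> W" "\<And>w. w \<in> W \<Longrightarrow> p w = w"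
proof -
  obtain C where C: "finite C" "independent C" "span C = W" "card C = dim W"
    using obtain_basis[OF W] by blast
  have "C \<subseteq> V" using C(3) W span_superset by blast
  then obtain B where B: "C \<subseteq> B" "B \<subseteq> V" "independent B" "V \<subseteq> span B"
    using maximal_independent_subset_extend C(2) by metis
  show thesis
  proof (rule that[of "\<lambda>v. \<Sum>b\<in>C. s (representation B v b) b"])
    fix v w c assume v: "v \<in> V" and w: "w \<in> V"
    show "(\<Sum>b\<in>C. s (representation B (v + w) b) b)
        = (\<Sum>b\<in>C. s (representation B v b) b) + (\<Sum>b\<in>C. s (representation B w b) b)"
      using B v w by (simp add: representation_add subset_iff scale_left_distrib sum.distrib)
  next
    fix v c assume v: "v \<in> V"
    show "(\<Sum>b\<in>C. s (representation B (s c v) b) b) = s c (\<Sum>b\<in>C. s (representation B v b) b)"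
      using B v by (simp add: representation_scale subset_iff scale_sum_right)
    show "(\<Sum>b\<in>C. s (representation B v b) b) \<in> W"
      using C(3) by (auto intro: span_sum span_scale span_base)
  next
    fix w assume w: "w \<in> W"
    have "representation B w = representation C w"
      using representation_extend B C w by blast
    then show "(\<Sum>b\<in>C. s (representation B w b) b) = w"
      using sum_representation_eq[of C w C] C w by simp
  qed
qed

lemma linear_endo_scaled:
  assumes "linear_endo T" shows "linear_endo (\<lambda>v. s c (T v))"
  using linear_endoD[OF assms] subspace_scale[OF subspace_V]
  unfolding linear_endo_def by (simp add: scale_right_distrib mult.commute)

lemma equivariant_endo_scaled:
  assumes "equivariant_endo T" shows "equivariant_endo (\<lambda>v. s c (T v))"
  using assms linear_endo_scaled[of T c] linear_endoD(1)[of T] rep_scale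
  unfolding equivariant_endo_def by simp

text \<open>Averaging a linear projection keeps its image in \<open>W\<close> by invariance. On
  \<open>W\<close> every summand of the average is the identity, whence the factor
  \<open>1 / n\<close> with \<open>n\<close> the order of the group.\<close>

lemma maschke_projection:
  assumes fin: "finite (carrier G)" and W: "subrep W"
  obtains P where "equivariant_endo P" "\<And>v. v \<in> V \<Longrightarrow> P v \<in> W" "\<And>w. w \<in> W \<Longrightarrow> P w = w"
proof -
  obtain p where p: "\<And>v w. v \<in> V \<Longrightarrow> w \<in> V \<Longrightarrow> p (v + w) = p v + p w"
    "\<And>c v. v \<in> V \<Longrightarrow> p (s c v) = s c (p v)"
    "\<And>v. v \<in> V \<Longrightarrow> p v \<in> W" "\<And>w. w \<in> W \<Longrightarrow> p w = w"
    using linear_projection[OF subrepD(1,2)[OF W]] by blast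
  define n :: complex where "n = of_nat (card (carrier G))"
  have "n \<noteq> 0" using fin one_closed by (auto simp: n_def)
  define P where "P v = s (1 / n) (\<Sum>g\<in>carrier G. \<rho> g (p (\<rho> (inv g) v)))" for v
  show thesis
  proof (rule that)
    have "equivariant_endo (\<lambda>v. \<Sum>g\<in>carrier G. \<rho> g (p (\<rho> (inv g) v)))"
      by (rule equivariant_average[OF fin p(1,2)]) (use p(3) subrepD(2)[OF W] in auto)
    then show "equivariant_endo P" unfolding P_def by (rule equivariant_endo_scaled)
    show "P v \<in> W" if "v \<in> V" for v
      unfolding P_def using that subrepD[OF W]
      by (intro subspace_scale subspace_sum) (auto simp: p(3) rep_closed)
    show "P w = w" if w: "w \<in> W" for w
    proof -
      have "(\<Sum>g\<in>carrier G. \<rho> g (p (\<rho> (inv g) w))) = (\<Sum>g\<in>carrier G. w)"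
        by (rule sum.cong) (use w subrepD[OF W] in \<open>auto simp: p(4) rep_inv subset_iff\<close>)
      also have "\<dots> = s n w" by (simp add: n_def sum_constant_scale)
      finally show ?thesis using \<open>n \<noteq> 0\<close> by (simp add: P_def)
    qed
  qed
qed

text \<open>A nonzero subrepresentation of \<open>U\<close> of least dimension is
  irreducible.\<close>

lemma irreducible_subrep_exists:
  assumes U: "subrep U" "U \<noteq> {0}"
  obtains W where "subrep W" "W \<subseteq> U" "irreducible_complex_rep G s W \<rho>"
proof -
  obtain W where W: "subrep W \<and> W \<subseteq> U \<and> W \<noteq> {0}"
    and min: "\<And>W'. subrep W' \<and> W' \<subseteq> U \<and> W' \<noteq> {0} \<Longrightarrow> dim W \<le> dim W'"
    using ex_has_least_nat[of "\<lambda>W. subrep W \<and> W \<subseteq> U \<and> W \<noteq> {0}" U dim] U by blast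
  interpret W: complex_rep G s W \<rho> using complex_rep_subrep W by blast
  have "irreducible_complex_rep G s W \<rho>"
  proof unfold_locales
    show "W \<noteq> {0}" using W by simp
    fix X assume X: "subspace X" "X \<subseteq> W" "\<And>g. g \<in> carrier G \<Longrightarrow> \<rho> g ` X \<subseteq> X"
    have "subspace W" "W \<subseteq> V" using W subrepD by auto
    have "subrep X" using X \<open>W \<subseteq> V\<close> by (simp add: subrep_def)
    show "X = {0} \<or> X = W"
    proof (rule ccontr)
      assume neg: "\<not> (X = {0} \<or> X = W)"
      have "X \<subseteq> U" using X(2) W by auto
      then have "dim W \<le> dim X" using min[of X] \<open>subrep X\<close> neg by simp
      moreover have "dim X < dim W"
        using dim_less[OF \<open>subspace W\<close> \<open>W \<subseteq> V\<close> X(1)] X(2) neg by (simp add: psubset_eq)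
      ultimately show False by simp
    qed
  qed
  with W that show thesis by blast
qed

text \<open>An irreducible \<open>W\<close> inside \<open>U\<close> is split off by an equivariant
  projection \<open>P\<close>; the kernel of \<open>P\<close> in \<open>U\<close> is an invariant
  complement of smaller dimension. The claim ranges over all subrepresentations \<open>U\<close> of
  the fixed \<open>V\<close> so that the induction stays inside one locale.\<close>

lemma complete_reducibility:
  assumes fin: "finite (carrier G)" and "subrep U"
  shows "\<exists>\<W>. finite \<W> \<and> (\<forall>W\<in>\<W>. subrep W \<and> W \<subseteq> U \<and> irreducible_complex_rep G s W \<rho>)
     \<and> bij_betw (\<lambda>w. \<Sum>W\<in>\<W>. w W) (\<Pi>\<^sub>E W\<in>\<W>. W) U"
  using assms(2)
proof (induction "dim U" arbitrary: U rule: less_induct)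
  case less
  note U = \<open>subrep U\<close>
  show ?case
  proof (cases "U = {0}")
    case True
    \<comment> \<open>For the empty family the product space has exactly one element, and its sum is
      0.\<close>
    then show ?thesis
      by (intro exI[of _ "{}"]) (auto simp: bij_betw_def)
  next
    case False
    then obtain W where W: "subrep W" "W \<subseteq> U" "irreducible_complex_rep G s W \<rho>"
      using irreducible_subrep_exists[OF U] by blast
    then have W0: "W \<noteq> {0}" by (simp add: irreducible_complex_rep.nonzero)
    obtain P where P: "equivariant_endo P" "\<And>v. v \<in> V \<Longrightarrow> P v \<in> W" "\<And>w. w \<in> W \<Longrightarrow> P w = w"
      using maschke_projection[OF fin W(1)] by blast
    have Pl: "linear_endo P" and Pe: "\<And>g x. g \<in> carrier G \<Longrightarrow> x \<in> V \<Longrightarrow> P (\<rho> g x) = \<rho> g (P x)"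
      using P(1) unfolding equivariant_endo_def by auto
    define X where "X = {u \<in> U. P u = 0}"
    note sU = subrepD[OF U] and sW = subrepD[OF W(1)]
    have UV: "x \<in> V" if "x \<in> U" for x using that sU(2) by blast
    have "subspace X"
      unfolding subspace_def X_def
      by (auto simp: subspace_0[OF sU(1)] subspace_add[OF sU(1)] subspace_scale[OF sU(1)]
          linear_endoD[OF Pl] linear_endo_zero[OF Pl] UV)
    moreover have "\<rho> g ` X \<subseteq> X" if g: "g \<in> carrier G" for g
      using sU(3) g linear_endo_zero[OF linear_endo_rep[OF g]] by (auto simp: X_def Pe UV)
    ultimately have X: "subrep X" using sU(2) unfolding subrep_def X_def by blast
    have WX: "w = 0" if "w \<in> W" "w \<in> X" for w using that P(3)[of w] by (simp add: X_def)
    have "X \<noteq> U"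
    proof
      assume "X = U"
      then have "W \<subseteq> {0}" using WX W(2) by blast
      then show False using W0 subspace_0[OF sW(1)] by blast
    qed
    then have "X \<subset> U" unfolding X_def by blast
    then have "dim X < dim U" using dim_less[OF sU(1,2) subrepD(1)[OF X]] by blast
    from less.hyps[OF this X] obtain \<W> where \<W>: "finite \<W>"
      "\<And>W. W \<in> \<W> \<Longrightarrow> subrep W \<and> W \<subseteq> X \<and> irreducible_complex_rep G s W \<rho>"
      and bij: "bij_betw (\<lambda>w. \<Sum>W\<in>\<W>. w W) (\<Pi>\<^sub>E W\<in>\<W>. W) X"
      by blast
    \<comment> \<open>The family is a set, so \<open>W\<close> must really be new: members of
      \<open>\<W>\<close> lie in \<open>X\<close>, which meets \<open>W\<close> only in 0, while
      \<open>W\<close> is nonzero.\<close>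
    have "W \<notin> \<W>"
      using \<W>(2) WX W0 subspace_0[OF sW(1)] by blast
    let ?\<W> = "insert W \<W>"
    have sumX: "(\<Sum>W\<in>\<W>. w W) \<in> X" if "w \<in> (\<Pi>\<^sub>E W\<in>?\<W>. W)" for w
      using that \<W>(2) by (intro subspace_sum subrepD(1)[OF X]) (auto simp: PiE_iff)
    have inj: "inj_on (\<lambda>w. \<Sum>W\<in>?\<W>. w W) (\<Pi>\<^sub>E W\<in>?\<W>. W)"
    proof (rule inj_onI)
      fix w w' assume w: "w \<in> (\<Pi>\<^sub>E W\<in>?\<W>. W)" and w': "w' \<in> (\<Pi>\<^sub>E W\<in>?\<W>. W)"
        and "(\<Sum>W\<in>?\<W>. w W) = (\<Sum>W\<in>?\<W>. w' W)"
      then have eq: "w W + (\<Sum>W\<in>\<W>. w W) = w' W + (\<Sum>W\<in>\<W>. w' W)"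
        using \<W>(1) \<open>W \<notin> \<W>\<close> by simp
      then have "w W - w' W = (\<Sum>W\<in>\<W>. w' W) - (\<Sum>W\<in>\<W>. w W)"
        by (simp add: algebra_simps)
      also have "\<dots> \<in> X" using sumX[OF w] sumX[OF w'] subspace_diff subrepD(1)[OF X] by blast
      finally have "w W - w' W \<in> X" .
      moreover have "w W - w' W \<in> W" using w w' subspace_diff[OF sW(1)] by (auto simp: PiE_iff)
      ultimately have wW: "w W = w' W" using WX by fastforce
      with eq have "(\<Sum>W\<in>\<W>. w W) = (\<Sum>W\<in>\<W>. w' W)" by simp
      then have "(\<Sum>W\<in>\<W>. restrict w \<W> W) = (\<Sum>W\<in>\<W>. restrict w' \<W> W)" by simp
      moreover have "restrict w \<W> \<in> (\<Pi>\<^sub>E W\<in>\<W>. W)" "restrict w' \<W> \<in> (\<Pi>\<^sub>E W\<in>\<W>. W)"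
        using w w' by (auto simp: PiE_iff)
      ultimately have "restrict w \<W> = restrict w' \<W>"
        using bij unfolding bij_betw_def inj_on_def by blast
      then have "w Y = w' Y" if "Y \<in> \<W>" for Y using that by (metis restrict_apply')
      then show "w = w'"
        using w w' wW by (intro PiE_ext[of w ?\<W> "\<lambda>W. W"]) auto
    qed
    have "(\<lambda>w. \<Sum>W\<in>?\<W>. w W) ` (\<Pi>\<^sub>E W\<in>?\<W>. W) = U"
    proof (intro equalityI subsetI)
      fix u assume "u \<in> (\<lambda>w. \<Sum>W\<in>?\<W>. w W) ` (\<Pi>\<^sub>E W\<in>?\<W>. W)"
      then obtain w where w: "w \<in> (\<Pi>\<^sub>E W\<in>?\<W>. W)" "u = w W + (\<Sum>W\<in>\<W>. w W)"
        using \<W>(1) \<open>W \<notin> \<W>\<close> by auto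
      then show "u \<in> U"
        using sumX[OF w(1)] \<open>X \<subset> U\<close> W(2) subspace_add[OF sU(1)] by (auto simp: PiE_iff)
    next
      fix u assume u: "u \<in> U"
      have Pu: "P u \<in> W" using P(2) UV u by blast
      \<comment> \<open>Surjectivity rests on the splitting
        \<open>u = P u + (u - P u)\<close>.\<close>
      have "u - P u \<in> X"
        using u Pu W(2) subspace_diff[OF sU(1)] P(3)[OF Pu] linear_endo_diff[OF Pl, of u "P u"]
        by (auto simp: X_def UV)
      then obtain w where w: "w \<in> (\<Pi>\<^sub>E W\<in>\<W>. W)" "(\<Sum>W\<in>\<W>. w W) = u - P u"
        using bij unfolding bij_betw_def by force
      have "(\<Sum>Y\<in>\<W>. (w(W := P u)) Y) = (\<Sum>Y\<in>\<W>. w Y)"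
        using \<open>W \<notin> \<W>\<close> by (intro sum.cong) auto
      then have "(\<Sum>Y\<in>?\<W>. (w(W := P u)) Y) = u"
        using w(2) \<W>(1) \<open>W \<notin> \<W>\<close> by simp
      moreover have "w(W := P u) \<in> (\<Pi>\<^sub>E W\<in>?\<W>. W)"
        using w(1) Pu by (auto simp: PiE_iff extensional_def)
      ultimately show "u \<in> (\<lambda>w. \<Sum>W\<in>?\<W>. w W) ` (\<Pi>\<^sub>E W\<in>?\<W>. W)"
        by (metis (no_types, lifting) imageI)
    qed
    with inj have "bij_betw (\<lambda>w. \<Sum>W\<in>?\<W>. w W) (\<Pi>\<^sub>E W\<in>?\<W>. W) U"
      unfolding bij_betw_def by blast
    then show ?thesis
      using \<W> W \<open>X \<subset> U\<close> by (intro exI[of _ ?\<W>]) auto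
  qed
qed

text \<open>If \<open>T\<close> maps a summand \<open>W\<close> isomorphically to another summand
  \<open>W'\<close>, then \<open>T\<close> after a projection \<open>P\<close> onto \<open>W\<close>
  should fail to commute with a projection \<open>Q\<close> onto \<open>W'\<close>. These
  projections come from Maschke's theorem and not from the decomposition, so \<open>Q\<close> need
  not kill \<open>W\<close>; commutation therefore yields the contradiction in the form
  \<open>W \<subseteq> W'\<close>.\<close>

theorem multiplicity_free_if_endo_commute:
  assumes fin: "finite (carrier G)"
    and comm: "\<And>S T v. equivariant_endo S \<Longrightarrow> equivariant_endo T \<Longrightarrow> v \<in> V \<Longrightarrow> S (T v) = T (S v)"
  shows "multiplicity_free G s V \<rho>"
proof -
  have "subrep V" unfolding subrep_def using subspace_V rep_closed by blast
  then obtain \<W> where \<W>: "finite \<W>"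
    "\<And>W. W \<in> \<W> \<Longrightarrow> subrep W \<and> irreducible_complex_rep G s W \<rho>"
    "bij_betw (\<lambda>w. \<Sum>W\<in>\<W>. w W) (\<Pi>\<^sub>E W\<in>\<W>. W) V"
    using complete_reducibility[OF fin] by metis
  have "\<not> rep_iso G s W \<rho> s W' \<rho>" if W: "W \<in> \<W>" and W': "W' \<in> \<W>" and "W \<noteq> W'" for W W'
  proof
    assume "rep_iso G s W \<rho> s W' \<rho>"
    then obtain T where T: "bij_betw T W W'"
      "\<And>x y. x \<in> W \<Longrightarrow> y \<in> W \<Longrightarrow> T (x + y) = T x + T y"
      "\<And>c x. x \<in> W \<Longrightarrow> T (s c x) = s c (T x)"
      "\<And>g x. g \<in> carrier G \<Longrightarrow> x \<in> W \<Longrightarrow> T (\<rho> g x) = \<rho> g (T x)"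
      unfolding rep_iso_def by blast
    have sW: "subrep W" and sW': "subrep W'" using \<W>(2) W W' by auto
    obtain P where P: "equivariant_endo P" "\<And>v. v \<in> V \<Longrightarrow> P v \<in> W" "\<And>w. w \<in> W \<Longrightarrow> P w = w"
      using maschke_projection[OF fin sW] by blast
    obtain Q where Q: "equivariant_endo Q" "\<And>v. v \<in> V \<Longrightarrow> Q v \<in> W'" "\<And>w. w \<in> W' \<Longrightarrow> Q w = w"
      using maschke_projection[OF fin sW'] by blast
    have TW': "T w \<in> W'" if "w \<in> W" for w using that T(1) bij_betwE by blast
    have TP: "equivariant_endo (\<lambda>v. T (P v))"
      using P(1,2) T TW' subrepD(2)[OF sW'] unfolding equivariant_endo_def linear_endo_def by auto
    have "W \<subseteq> W'"
    proof
      fix w assume w: "w \<in> W"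
      then have wV: "w \<in> V" using subrepD(2)[OF sW] by blast
      then have QV: "Q w \<in> V" using Q(2) subrepD(2)[OF sW'] by blast
      have "T (P (Q w)) = Q (T (P w))" by (rule comm[OF TP Q(1) wV])
      also have "\<dots> = T w" using Q(3) TW' P(3) w by simp
      finally have "P (Q w) = w"
        using T(1) P(2)[OF QV] w by (auto simp: bij_betw_def inj_on_def)
      \<comment> \<open>Commuting \<open>P\<close> with \<open>Q\<close> turns
        \<open>P (Q w) = w\<close> into \<open>Q (P w) = w\<close>, and
        \<open>P w = w\<close>.\<close>
      then have "Q w = w" using comm[OF P(1) Q(1) wV] P(3)[OF w] by simp
      then show "w \<in> W'" using Q(2)[OF wV] by simp
    qed
    moreover have "\<rho> g ` W \<subseteq> W" if "g \<in> carrier G" for g using subrepD(3)[OF sW that] by blast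
    ultimately have "W = {0} \<or> W = W'"
      using \<W>(2)[OF W'] irreducible_complex_rep.irreducible[of G s W' \<rho> W] subrepD(1)[OF sW]
      by blast
    moreover have "W \<noteq> {0}"
      using \<W>(2)[OF W] irreducible_complex_rep.nonzero by blast
    ultimately show False using \<open>W \<noteq> W'\<close> by blast
  qed
  then show ?thesis
    unfolding multiplicity_free_def using \<W> complex_rep_axioms by blast
qed

end

section \<open>Orthogonality of matrix coefficients\<close>

text \<open>The sum is the average of the rank-one map \<open>w \<mapsto> \<mu>(w) v\<close>, hence
  a scalar by Schur's lemma, and the scalar is found from the trace. Using forms in place of an
  inner product avoids any unitary structure.\<close>

lemma (in irreducible_complex_rep) matrix_coefficient_orthogonality:
  assumes fin: "finite (carrier G)" and B: "finite B" "independent B" "span B = V"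
    and \<mu>: "linear_form \<mu>" and v: "v \<in> V" and w: "w \<in> V"
  shows "s (of_nat (card B)) (\<Sum>g\<in>carrier G. s (\<mu> (\<rho> (inv g) w)) (\<rho> g v))
    = s (of_nat (card (carrier G)) * \<mu> v) w"
proof -
  define M where "M w = (\<Sum>g\<in>carrier G. \<rho> g (s (\<mu> (\<rho> (inv g) w)) v))" for w
  have "equivariant_endo M"
    unfolding M_def
    by (rule equivariant_average[OF fin])
      (auto simp: linear_formD[OF \<mu>] scale_left_distrib subspace_scale[OF subspace_V] v)
  then obtain c where c: "\<And>x. x \<in> V \<Longrightarrow> M x = s c x" using schur by blast
  have M: "M w = (\<Sum>g\<in>carrier G. s (\<mu> (\<rho> (inv g) w)) (\<rho> g v))" for w
    unfolding M_def using v by (intro sum.cong) (auto simp: rep_scale)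
  have BV: "b \<in> V" if "b \<in> B" for b using that B span_superset by blast
  \<comment> \<open>The trace of \<open>M\<close> is computed twice: as the trace of a scalar, and
    term by term, where each \<open>g\<close> contributes the trace \<open>\<mu> v\<close> of the
    rank-one map.\<close>
  have "of_nat (card B) * c = (\<Sum>b\<in>B. representation B (M b) b)"
    using B BV by (simp add: c representation_scale representation_basis)
  also have "\<dots> = (\<Sum>b\<in>B. \<Sum>g\<in>carrier G. \<mu> (\<rho> (inv g) b) * representation B (\<rho> g v) b)"
    unfolding M using v
    by (intro sum.cong linear_form_sum[OF linear_form_representation[OF B(2,3)]])
      (auto simp: rep_closed)
  also have "\<dots> = (\<Sum>g\<in>carrier G. \<Sum>b\<in>B. representation B (\<rho> g v) b * \<mu> (\<rho> (inv g) b))"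
    by (subst sum.swap) (simp add: mult.commute)
  also have "\<dots> = (\<Sum>g\<in>carrier G. \<mu> v)"
  proof (rule sum.cong[OF refl])
    fix g assume g: "g \<in> carrier G"
    have "(\<Sum>b\<in>B. representation B (\<rho> g v) b * \<mu> (\<rho> (inv g) b))
        = \<mu> (\<rho> (inv g) (\<Sum>b\<in>B. s (representation B (\<rho> g v) b) b))"
      using g BV
      by (intro linear_form_sum[OF linear_form_comp[OF \<mu> linear_endo_rep], symmetric]) auto
    also have "(\<Sum>b\<in>B. s (representation B (\<rho> g v) b) b) = \<rho> g v"
      using sum_representation_eq[of B "\<rho> g v" B] B rep_closed[OF g v] by simp
    finally show "(\<Sum>b\<in>B. representation B (\<rho> g v) b * \<mu> (\<rho> (inv g) b)) = \<mu> v"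
      using rep_inv g v by simp
  qed
  finally have "of_nat (card B) * c = of_nat (card (carrier G)) * \<mu> v" by simp
  then show ?thesis using c[OF w] by (simp add: M[symmetric])
qed

text \<open>Fourier inversion on one irreducible representation: \<open>E\<close> is
  \<open>dim V / |G|\<close> times the sum of \<open>tr(E \<rho>(g)\<inverse>) \<rho>(g)\<close>. It
  follows from orthogonality by taking for \<open>\<mu>\<close> the \<open>b\<close>-coordinate of
  \<open>E\<close>, for \<open>w\<close> the vector \<open>b\<close>, and summing over the
  basis.\<close>

lemma (in irreducible_complex_rep) endo_trace_expansion:
  assumes fin: "finite (carrier G)" and B: "finite B" "independent B" "span B = V"
    and E: "linear_endo E" and v: "v \<in> V"
  shows "s (of_nat (card B)) (\<Sum>g\<in>carrier G. s (trace_wrt B (\<lambda>x. E (\<rho> (inv g) x))) (\<rho> g v))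
    = s (of_nat (card (carrier G))) (E v)"
proof -
  have BV: "b \<in> V" if "b \<in> B" for b using that B span_superset by blast
  have "s (of_nat (card B)) (\<Sum>g\<in>carrier G. s (trace_wrt B (\<lambda>x. E (\<rho> (inv g) x))) (\<rho> g v))
    = (\<Sum>b\<in>B. s (of_nat (card B))
        (\<Sum>g\<in>carrier G. s (representation B (E (\<rho> (inv g) b)) b) (\<rho> g v)))"
    unfolding trace_wrt_def scale_sum_left scale_sum_right by (rule sum.swap)
  also have "\<dots> = (\<Sum>b\<in>B. s (of_nat (card (carrier G)) * representation B (E v) b) b)"
    using BV v
    by (intro sum.cong matrix_coefficient_orthogonality[OF fin B
          linear_form_comp[OF linear_form_representation[OF B(2,3)] E]]) auto
  also have "\<dots> = s (of_nat (card (carrier G))) (\<Sum>b\<in>B. s (representation B (E v) b) b)"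
    by (simp add: scale_sum_right)
  also have "(\<Sum>b\<in>B. s (representation B (E v) b) b) = E v"
    using sum_representation_eq[of B "E v" B] B linear_endoD(1)[OF E v] by simp
  finally show ?thesis .
qed

section \<open>Endomorphisms of induced representations\<close>

lemma sum_fun_apply: "(\<Sum>i\<in>I. f i) x = (\<Sum>i\<in>I. f i x)"
  by (induction I rule: infinite_finite_induct) auto

lemma (in group) inv_cancel_left:
  assumes "x \<in> carrier G" "y \<in> carrier G"
  shows "inv x \<otimes> (x \<otimes> y) = y" "x \<otimes> (inv x \<otimes> y) = y"
  using assms by (simp_all add: m_assoc[symmetric])

locale induced_rep = group G + irr: irreducible_complex_rep "G\<lparr>carrier := K\<rparr>" s V \<rho>
  for G :: "('g, 'm) monoid_scheme" (structure) and K and s :: "complex \<Rightarrow> 'v::ab_group_add \<Rightarrow> 'v" and V \<rho> +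
  assumes finite_G: "finite (carrier G)" and K_subgroup: "subgroup K G"
begin

lemma K_carrier: "k \<in> K \<Longrightarrow> k \<in> carrier G"
  using subgroup.mem_carrier[OF K_subgroup] .

lemma finite_K: "finite K"
  using finite_subset[OF subgroup.subset[OF K_subgroup] finite_G] .

lemma K_mult: "k \<in> K \<Longrightarrow> l \<in> K \<Longrightarrow> k \<otimes> l \<in> K"
  using subgroup.m_closed[OF K_subgroup] .

lemma K_inv: "k \<in> K \<Longrightarrow> inv k \<in> K"
  using subgroup.m_inv_closed[OF K_subgroup] .

lemma card_K: "of_nat (card K) \<noteq> (0 :: complex)"
  using finite_K subgroup.one_closed[OF K_subgroup] by auto

text \<open>Facts about the representation of \<open>K\<close> mention the inverse of the restricted
  structure; this translates it to the inverse in \<open>G\<close>.\<close>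

lemma inv_K: "k \<in> K \<Longrightarrow> inv\<^bsub>G\<lparr>carrier := K\<rparr>\<^esub> k = inv k"
  using m_inv_consistent[OF K_subgroup] .

lemmas rho_closed = irr.rep_closed[simplified]
  and rho_mult = irr.rep_mult[simplified]
  and rho_add = irr.rep_add[simplified]
  and rho_scale = irr.rep_scale[simplified]

lemma rho_inv:
  assumes "k \<in> K" "v \<in> V"
  shows "\<rho> (inv k) (\<rho> k v) = v" "\<rho> k (\<rho> (inv k) v) = v"
  using irr.rep_inv[of k v] assms by (simp_all add: inv_K)

lemmas V_zero = irr.subspace_0[OF irr.subspace_V]
  and V_add = irr.subspace_add[OF irr.subspace_V]
  and V_scale = irr.subspace_scale[OF irr.subspace_V]
  and V_sum = irr.subspace_sum[OF irr.subspace_V]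

lemma rho_zero: "k \<in> K \<Longrightarrow> \<rho> k 0 = 0"
  using irr.linear_endo_zero[OF irr.linear_endo_rep[of k]] by simp

lemma rho_sum: "k \<in> K \<Longrightarrow> (\<And>i. i \<in> A \<Longrightarrow> f i \<in> V) \<Longrightarrow> \<rho> k (sum f A) = (\<Sum>i\<in>A. \<rho> k (f i))"
  using irr.linear_endo_sum[OF irr.linear_endo_rep[of k], of A f] by simp

lemma ind_spaceD:
  assumes "f \<in> ind_space G K V \<rho>"
  shows "x \<notin> carrier G \<Longrightarrow> f x = 0" "x \<in> carrier G \<Longrightarrow> f x \<in> V"
    "k \<in> K \<Longrightarrow> x \<in> carrier G \<Longrightarrow> f (k \<otimes> x) = \<rho> k (f x)"
  using assms unfolding ind_space_def by auto

sublocale ind: vector_space "ind_scale s :: complex \<Rightarrow> ('g \<Rightarrow> 'v) \<Rightarrow> 'g \<Rightarrow> 'v"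
  by unfold_locales (auto simp: ind_scale_def irr.scale_right_distrib irr.scale_left_distrib)

lemma ind_subspace: "ind.subspace (ind_space G K V \<rho>)"
  unfolding ind.subspace_def ind_space_def
  by (auto simp: ind_scale_def V_zero V_add V_scale rho_zero rho_add rho_scale)

text \<open>The point functions \<delta> span a space containing \<open>ind_space\<close>, but in
  general they are not \<open>K\<close>-equivariant and so lie outside it. They only bound the size
  of an independent set \<open>C\<close> chosen inside.\<close>

lemma ind_finite_dim: "\<exists>B. finite B \<and> ind_space G K V \<rho> = ind.span B"
proof -
  obtain B where B: "finite B" "irr.independent B" "irr.span B = V"
    using irr.obtain_basis[OF irr.subspace_V order_refl] by blast
  define \<delta> where "\<delta> = (\<lambda>(x :: 'g, b) y. if y = x then b else (0::'v))"
  let ?D = "\<delta> ` (carrier G \<times> B)"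
  have "f \<in> ind.span ?D" if f: "f \<in> ind_space G K V \<rho>" for f
  proof -
    have "f = (\<Sum>x\<in>carrier G. \<Sum>b\<in>B. ind_scale s (irr.representation B (f x) b) (\<delta> (x, b)))"
    proof
      fix y
      have "(\<Sum>x\<in>carrier G. \<Sum>b\<in>B. ind_scale s (irr.representation B (f x) b) (\<delta> (x, b))) y
          = (\<Sum>x\<in>carrier G. if x = y then \<Sum>b\<in>B. s (irr.representation B (f x) b) b else 0)"
        unfolding sum_fun_apply ind_scale_def \<delta>_def by (intro sum.cong) auto
      also have "\<dots> = (if y \<in> carrier G then \<Sum>b\<in>B. s (irr.representation B (f y) b) b else 0)"
        using finite_G by simp
      also have "\<dots> = f y"
        using ind_spaceD(1,2)[OF f] irr.sum_representation_eq[of B _ B] B by auto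
      finally show "f y = (\<Sum>x\<in>carrier G. \<Sum>b\<in>B.
          ind_scale s (irr.representation B (f x) b) (\<delta> (x, b))) y" by simp
    qed
    also have "\<dots> \<in> ind.span ?D"
      by (intro ind.span_sum ind.span_scale ind.span_base) auto
    finally show ?thesis .
  qed
  moreover obtain C where C: "C \<subseteq> ind_space G K V \<rho>" "ind.independent C"
    "ind_space G K V \<rho> \<subseteq> ind.span C"
    using ind.maximal_independent_subset by metis
  moreover have "finite ?D" using finite_G B by simp
  ultimately have "finite C" using ind.independent_span_bound by blast
  then show ?thesis using C ind.span_minimal[OF C(1) ind_subspace] by blast
qed

sublocale ind: complex_rep G "ind_scale s" "ind_space G K V \<rho>" "ind_action G"
proof unfold_locales
  fix g x assume g: "g \<in> carrier G" and "x \<in> ind_space G K V \<rho>"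
  then show "ind_action G g x \<in> ind_space G K V \<rho>"
    unfolding ind_space_def ind_action_def using K_carrier by (auto simp: m_assoc)
qed (auto simp: ind_finite_dim ind_action_def ind_scale_def m_assoc fun_eq_iff ind_spaceD)

text \<open>The canonical \<open>K\<close>-equivariant embedding of \<open>V\<close> into the
  induced representation: the function supported on \<open>K\<close> with value \<open>v\<close> at
  the identity. An endomorphism is determined by its values on these functions.\<close>

definition bump :: "'v \<Rightarrow> 'g \<Rightarrow> 'v" where
  "bump v = (\<lambda>x. if x \<in> K then \<rho> x v else 0)"

lemma mult_mem_K:
  assumes "k \<in> K" "x \<in> carrier G"
  shows "k \<otimes> x \<in> K \<longleftrightarrow> x \<in> K" "x \<otimes> k \<in> K \<longleftrightarrow> x \<in> K"
proof -
  have "inv k \<otimes> (k \<otimes> x) = x" "(x \<otimes> k) \<otimes> inv k = x"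
    using assms K_carrier by (simp_all add: m_assoc[symmetric]) (simp add: m_assoc)
  then show "k \<otimes> x \<in> K \<longleftrightarrow> x \<in> K" "x \<otimes> k \<in> K \<longleftrightarrow> x \<in> K"
    using assms K_mult K_inv by metis+
qed

lemma bump_closed: "v \<in> V \<Longrightarrow> bump v \<in> ind_space G K V \<rho>"
  unfolding ind_space_def bump_def
  using K_carrier by (auto simp: mult_mem_K K_mult rho_mult rho_closed V_zero rho_zero)

lemma bump_rho: "k \<in> K \<Longrightarrow> v \<in> V \<Longrightarrow> bump (\<rho> k v) = ind_action G k (bump v)"
  unfolding bump_def ind_action_def
  using K_carrier by (auto simp: mult_mem_K K_mult rho_mult fun_eq_iff)

text \<open>The summand for \<open>x\<close> is the restriction of \<open>f\<close> to the coset
  \<open>K x\<close>. Summing over all of \<open>G\<close> avoids a choice of coset representatives;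
  each \<open>y\<close> is then counted once for every \<open>x\<close> in \<open>K y\<close>,
  whence the factor \<open>card K\<close>.\<close>

lemma ind_generated_by_bumps:
  assumes f: "f \<in> ind_space G K V \<rho>"
  shows "ind_scale s (of_nat (card K)) f
    = (\<Sum>x\<in>carrier G. ind_action G (inv x) (bump (f x)))"
proof
  fix y
  show "ind_scale s (of_nat (card K)) f y
    = (\<Sum>x\<in>carrier G. ind_action G (inv x) (bump (f x))) y"
  proof (cases "y \<in> carrier G")
    case False
    then show ?thesis
      using ind_spaceD(1)[OF f] by (simp add: sum_fun_apply ind_scale_def ind_action_def)
  next
    case y: True
    have "(\<Sum>x\<in>carrier G. ind_action G (inv x) (bump (f x))) y
        = (\<Sum>x\<in>carrier G. if y \<otimes> inv x \<in> K then f y else 0)"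
      unfolding sum_fun_apply
    proof (rule sum.cong[OF refl])
      fix x assume x: "x \<in> carrier G"
      have "(y \<otimes> inv x) \<otimes> x = y" using x y by (simp add: m_assoc)
      then show "ind_action G (inv x) (bump (f x)) y = (if y \<otimes> inv x \<in> K then f y else 0)"
        using ind_spaceD(3)[OF f _ x, of "y \<otimes> inv x"] y by (simp add: ind_action_def bump_def)
    qed
    also have "\<dots> = (\<Sum>x\<in>{x \<in> carrier G. y \<otimes> inv x \<in> K}. f y)"
      using finite_G by (simp add: sum.inter_filter)
    also have "\<dots> = (\<Sum>k\<in>K. f y)"
      by (rule sum.reindex_bij_witness[of _ "\<lambda>k. inv k \<otimes> y" "\<lambda>x. y \<otimes> inv x"])
        (use y K_carrier in \<open>auto simp: inv_mult_group m_assoc inv_cancel_left\<close>)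
    also have "\<dots> = s (of_nat (card K)) (f y)"
      by (rule irr.sum_constant_scale)
    finally show ?thesis by (simp add: ind_scale_def)
  qed
qed

section \<open>Endomorphisms as convolutions, and Gelfand's trick\<close>

definition conj_invariant :: "('g \<Rightarrow> complex) \<Rightarrow> bool" where
  "conj_invariant \<phi> \<longleftrightarrow> (\<forall>k\<in>K. \<forall>x\<in>carrier G. \<phi> (k \<otimes> x \<otimes> inv k) = \<phi> x)"

definition convolve :: "('g \<Rightarrow> complex) \<Rightarrow> ('g \<Rightarrow> 'v) \<Rightarrow> 'g \<Rightarrow> 'v" where
  "convolve \<phi> f = (\<lambda>x. if x \<in> carrier G then \<Sum>y\<in>carrier G. s (\<phi> y) (f (inv y \<otimes> x)) else 0)"

text \<open>Left convolution commutes with right translation. Invariance of \<open>\<phi>\<close>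
  enters through the substitution \<open>y = k z k\<inverse>\<close>, which keeps the result inside
  \<open>ind_space\<close>.\<close>

lemma convolve_equivariant:
  assumes \<phi>: "conj_invariant \<phi>"
  shows "ind.equivariant_endo (convolve \<phi>)"
  unfolding ind.equivariant_endo_def ind.linear_endo_def
proof (intro conjI ballI allI)
  fix f assume f: "f \<in> ind_space G K V \<rho>"
  have "convolve \<phi> f (k \<otimes> x) = \<rho> k (convolve \<phi> f x)" if k: "k \<in> K" and x: "x \<in> carrier G" for k x
  proof -
    have kG: "k \<in> carrier G" using k K_carrier by blast
    have "(\<Sum>y\<in>carrier G. s (\<phi> y) (f (inv y \<otimes> (k \<otimes> x))))
        = (\<Sum>z\<in>carrier G. s (\<phi> (k \<otimes> z \<otimes> inv k)) (f (inv (k \<otimes> z \<otimes> inv k) \<otimes> (k \<otimes> x))))"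
      by (rule sum.reindex_bij_witness[of _ "\<lambda>z. k \<otimes> z \<otimes> inv k" "\<lambda>y. inv k \<otimes> y \<otimes> k"])
        (use kG in \<open>auto simp: m_assoc inv_cancel_left\<close>)
    also have "\<dots> = (\<Sum>z\<in>carrier G. \<rho> k (s (\<phi> z) (f (inv z \<otimes> x))))"
    proof (rule sum.cong[OF refl])
      fix z assume z: "z \<in> carrier G"
      have "inv (k \<otimes> z \<otimes> inv k) \<otimes> (k \<otimes> x) = k \<otimes> (inv z \<otimes> (inv k \<otimes> (k \<otimes> x)))"
        using kG z x by (simp add: inv_mult_group m_assoc)
      also have "\<dots> = k \<otimes> (inv z \<otimes> x)" using kG x by (simp add: inv_cancel_left)
      finally show "s (\<phi> (k \<otimes> z \<otimes> inv k)) (f (inv (k \<otimes> z \<otimes> inv k) \<otimes> (k \<otimes> x)))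
          = \<rho> k (s (\<phi> z) (f (inv z \<otimes> x)))"
        using \<phi> k z x ind_spaceD(2,3)[OF f] by (simp add: conj_invariant_def rho_scale)
    qed
    also have "\<dots> = \<rho> k (\<Sum>z\<in>carrier G. s (\<phi> z) (f (inv z \<otimes> x)))"
      using x ind_spaceD(2)[OF f] by (intro rho_sum[OF k, symmetric] V_scale) auto
    finally show ?thesis using x kG by (simp add: convolve_def)
  qed
  then show "convolve \<phi> f \<in> ind_space G K V \<rho>"
    unfolding ind_space_def using ind_spaceD(2)[OF f]
    by (auto simp: convolve_def intro!: V_sum V_scale)
  fix f' assume f': "f' \<in> ind_space G K V \<rho>"
  show "convolve \<phi> (f + f') = convolve \<phi> f + convolve \<phi> f'"
    by (auto simp: convolve_def fun_eq_iff irr.scale_right_distrib sum.distrib)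
next
  fix c f
  show "convolve \<phi> (ind_scale s c f) = ind_scale s c (convolve \<phi> f)"
    by (auto simp: convolve_def fun_eq_iff ind_scale_def irr.scale_sum_right mult.commute)
next
  fix g f assume "g \<in> carrier G"
  then show "convolve \<phi> (ind_action G g f) = ind_action G g (convolve \<phi> f)"
    by (auto simp: convolve_def fun_eq_iff ind_action_def m_assoc intro!: sum.cong)
qed

text \<open>Brings the convolution to a sum over \<open>K\<close>, the shape to which the trace
  expansion for \<open>K\<close> applies.\<close>

lemma convolve_bump:
  assumes v: "v \<in> V" and x: "x \<in> carrier G"
  shows "convolve \<phi> (bump v) x = (\<Sum>k\<in>K. s (\<phi> (x \<otimes> inv k)) (\<rho> k v))"
proof -
  have "convolve \<phi> (bump v) x
      = (\<Sum>y\<in>carrier G. if inv y \<otimes> x \<in> K then s (\<phi> y) (\<rho> (inv y \<otimes> x) v) else 0)"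
    unfolding convolve_def bump_def using x by (auto intro!: sum.cong)
  also have "\<dots> = (\<Sum>y\<in>{y \<in> carrier G. inv y \<otimes> x \<in> K}. s (\<phi> y) (\<rho> (inv y \<otimes> x) v))"
    using finite_G by (simp add: sum.inter_filter)
  also have "\<dots> = (\<Sum>k\<in>K. s (\<phi> (x \<otimes> inv k)) (\<rho> k v))"
    by (rule sum.reindex_bij_witness[of _ "\<lambda>k. x \<otimes> inv k" "\<lambda>y. inv y \<otimes> x"])
      (use x K_carrier in \<open>auto simp: inv_mult_group m_assoc inv_cancel_left\<close>)
  finally show ?thesis .
qed

text \<open>The kernel of \<open>T\<close> is \<open>D x v = T (bump v) x\<close>, a function from
  \<open>G\<close> to endomorphisms of \<open>V\<close> satisfying
  \<open>D(k x) = \<rho>(k) D(x)\<close> and \<open>D(x k) = D(x) \<rho>(k)\<close>. Its trace,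
  suitably scaled, is the desired function \<open>\<phi>\<close>.\<close>

lemma equivariant_endo_is_convolution:
  assumes T: "ind.equivariant_endo T"
  obtains \<phi> where "conj_invariant \<phi>" "\<And>f. f \<in> ind_space G K V \<rho> \<Longrightarrow> T f = convolve \<phi> f"
proof -
  have Tl: "ind.linear_endo T"
    and Te: "\<And>g f. g \<in> carrier G \<Longrightarrow> f \<in> ind_space G K V \<rho> \<Longrightarrow>
      T (ind_action G g f) = ind_action G g (T f)"
    using T unfolding ind.equivariant_endo_def by auto
  obtain B where B: "finite B" "irr.independent B" "irr.span B = V"
    using irr.obtain_basis[OF irr.subspace_V order_refl] by blast
  have BV: "b \<in> V" if "b \<in> B" for b using that B irr.span_superset by blast
  define D where "D x v = T (bump v) x" for x v
  have bump_add: "bump (v + w) = bump v + bump w" if "v \<in> V" "w \<in> V" for v w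
    using that by (auto simp: bump_def rho_add)
  have bump_scale: "bump (s c v) = ind_scale s c (bump v)" if "v \<in> V" for c v
    using that by (auto simp: bump_def rho_scale ind_scale_def)
  have T_scale: "T (bump (s c v)) x = s c (T (bump v) x)" if "v \<in> V" for c v x
    unfolding bump_scale[OF that] ind.linear_endoD(3)[OF Tl bump_closed[OF that]]
    by (simp add: ind_scale_def)
  have D: "irr.linear_endo (D x)" if "x \<in> carrier G" for x
    unfolding irr.linear_endo_def D_def using that ind_spaceD(2)
    by (auto simp: bump_closed ind.linear_endoD[OF Tl] bump_add T_scale)
  have Dr: "D (x \<otimes> k) v = D x (\<rho> k v)" if "x \<in> carrier G" "k \<in> K" "v \<in> V" for x k v
    unfolding D_def bump_rho[OF that(2,3)] Te[OF K_carrier[OF that(2)] bump_closed[OF that(3)]]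
    using that by (simp add: ind_action_def)
  have Dl: "D (k \<otimes> x) v = \<rho> k (D x v)" if "x \<in> carrier G" "k \<in> K" "v \<in> V" for x k v
    unfolding D_def using that by (intro ind_spaceD(3) ind.linear_endoD(1)[OF Tl] bump_closed)
  \<comment> \<open>The factor \<open>dim V / |K|\<close> is the constant of the trace expansion for
    \<open>K\<close>.\<close>
  define \<phi> where "\<phi> x = of_nat (card B) / of_nat (card K) * irr.trace_wrt B (D x)" for x
  have "conj_invariant \<phi>"
    unfolding conj_invariant_def
  proof (intro ballI)
    fix k x assume k: "k \<in> K" and x: "x \<in> carrier G"
    have kk: "irr.linear_endo (\<rho> k)" "irr.linear_endo (\<lambda>v. D x (\<rho> (inv k) v))"
      using irr.linear_endo_rep[of k] irr.linear_endo_rep[of "inv k"] D[OF x] k K_inv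
      by (auto simp: irr.linear_endo_def)
    have "irr.trace_wrt B (D (k \<otimes> x \<otimes> inv k))
        = irr.trace_wrt B (\<lambda>v. \<rho> k (D x (\<rho> (inv k) v)))"
      unfolding irr.trace_wrt_def using k x K_inv K_carrier
      by (intro sum.cong) (auto simp: Dr Dl BV rho_closed)
    \<comment> \<open>Cyclicity of the trace brings \<open>\<rho> k\<close> next to
      \<open>\<rho> (inv k)\<close>.\<close>
    also have "\<dots> = irr.trace_wrt B (\<lambda>v. D x (\<rho> (inv k) (\<rho> k v)))"
      by (rule irr.trace_wrt_comp_commute[OF B kk])
    also have "\<dots> = irr.trace_wrt B (D x)"
      unfolding irr.trace_wrt_def using k by (intro sum.cong) (auto simp: BV rho_inv)
    finally show "\<phi> (k \<otimes> x \<otimes> inv k) = \<phi> x" by (simp add: \<phi>_def)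
  qed
  note C = convolve_equivariant[OF this]
  have Cl: "ind.linear_endo (convolve \<phi>)"
    and Ce: "\<And>g f. g \<in> carrier G \<Longrightarrow> f \<in> ind_space G K V \<rho> \<Longrightarrow>
      convolve \<phi> (ind_action G g f) = ind_action G g (convolve \<phi> f)"
    using C unfolding ind.equivariant_endo_def by auto
  have T_bump: "T (bump v) = convolve \<phi> (bump v)" if v: "v \<in> V" for v
  proof
    fix x
    show "T (bump v) x = convolve \<phi> (bump v) x"
    proof (cases "x \<in> carrier G")
      case False
      then show ?thesis
        using ind_spaceD(1)[OF ind.linear_endoD(1)[OF Tl bump_closed[OF v]]]
        by (simp add: convolve_def)
    next
      case x: True
      \<comment> \<open>Since \<open>D (x \<otimes> inv k)\<close> is \<open>D x\<close> after
        \<open>\<rho> (inv k)\<close>, the sum is the expansion of the single endomorphism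
        \<open>D x\<close>.\<close>
      have "convolve \<phi> (bump v) x = (\<Sum>k\<in>K. s (1 / of_nat (card K)) (s (of_nat (card B))
          (s (irr.trace_wrt B (\<lambda>w. D x (\<rho> (inv\<^bsub>G\<lparr>carrier := K\<rparr>\<^esub> k) w))) (\<rho> k v))))"
        unfolding convolve_bump[OF v x] \<phi>_def irr.trace_wrt_def
        using x K_inv by (intro sum.cong) (auto simp: inv_K Dr BV)
      also have "\<dots> = s (1 / of_nat (card K)) (s (of_nat (card K)) (D x v))"
        using irr.endo_trace_expansion[OF _ B D[OF x] v] finite_K
        by (simp add: irr.scale_sum_right[symmetric] del: irr.scale_scale)
      also have "\<dots> = T (bump v) x"
        using card_K by (simp add: D_def)
      finally show ?thesis ..
    qed
  qed
  have "T f = convolve \<phi> f" if f: "f \<in> ind_space G K V \<rho>" for f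
  proof -
    have fx: "ind_action G (inv x) (bump (f x)) \<in> ind_space G K V \<rho>" if "x \<in> carrier G" for x
      using that by (intro ind.rep_closed bump_closed ind_spaceD(2)[OF f]) auto
    have "ind_scale s (of_nat (card K)) (T f)
        = (\<Sum>x\<in>carrier G. T (ind_action G (inv x) (bump (f x))))"
      using ind.linear_endoD(3)[OF Tl f, of "of_nat (card K)"]
        ind.linear_endo_sum[OF Tl fx, of "carrier G" "\<lambda>x. x"]
      by (simp add: ind_generated_by_bumps[OF f])
    also have "\<dots> = (\<Sum>x\<in>carrier G. convolve \<phi> (ind_action G (inv x) (bump (f x))))"
      by (intro sum.cong refl)
        (simp add: Te Ce bump_closed ind_spaceD(2)[OF f] T_bump)
    also have "\<dots> = ind_scale s (of_nat (card K)) (convolve \<phi> f)"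
      using ind.linear_endoD(3)[OF Cl f, of "of_nat (card K)"]
        ind.linear_endo_sum[OF Cl fx, of "carrier G" "\<lambda>x. x"]
      by (simp add: ind_generated_by_bumps[OF f])
    finally show ?thesis using ind.scale_left_imp_eq[OF card_K] by blast
  qed
  with \<open>conj_invariant \<phi>\<close> show thesis using that by blast
qed

definition conv_mult :: "('g \<Rightarrow> complex) \<Rightarrow> ('g \<Rightarrow> complex) \<Rightarrow> 'g \<Rightarrow> complex" where
  "conv_mult \<phi> \<psi> g = (\<Sum>y\<in>carrier G. \<phi> y * \<psi> (inv y \<otimes> g))"

text \<open>With \<open>g = y \<otimes> z\<close>, composition becomes the product of the group
  algebra, so commutation of endomorphisms reduces to a statement about scalar functions.\<close>

lemma convolve_convolve: "convolve \<phi> (convolve \<psi> f) = convolve (conv_mult \<phi> \<psi>) f"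
proof
  fix x
  show "convolve \<phi> (convolve \<psi> f) x = convolve (conv_mult \<phi> \<psi>) f x"
  proof (cases "x \<in> carrier G")
    case x: True
    have "convolve \<phi> (convolve \<psi> f) x = (\<Sum>y\<in>carrier G. \<Sum>z\<in>carrier G.
        s (\<phi> y * \<psi> z) (f (inv z \<otimes> (inv y \<otimes> x))))"
      using x by (auto simp: convolve_def irr.scale_sum_right intro!: sum.cong)
    also have "\<dots> = (\<Sum>y\<in>carrier G. \<Sum>g\<in>carrier G.
        s (\<phi> y * \<psi> (inv y \<otimes> g)) (f (inv g \<otimes> x)))"
    proof (rule sum.cong[OF refl])
      fix y assume y: "y \<in> carrier G"
      show "(\<Sum>z\<in>carrier G. s (\<phi> y * \<psi> z) (f (inv z \<otimes> (inv y \<otimes> x))))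
          = (\<Sum>g\<in>carrier G. s (\<phi> y * \<psi> (inv y \<otimes> g)) (f (inv g \<otimes> x)))"
        by (rule sum.reindex_bij_witness[of _ "\<lambda>g. inv y \<otimes> g" "\<lambda>z. y \<otimes> z"])
          (use x y in \<open>auto simp: m_assoc[symmetric] inv_mult_group\<close>)
    qed
    also have "\<dots> = convolve (conv_mult \<phi> \<psi>) f x"
      using x by (subst sum.swap) (simp add: convolve_def conv_mult_def irr.scale_sum_left)
    finally show ?thesis .
  qed (simp add: convolve_def)
qed

text \<open>Gelfand's trick: \<open>\<theta>\<close> reverses convolution products but fixes the functions invariant under
  conjugation by \<open>K\<close>.\<close>

lemma conv_mult_commute:
  assumes bij: "bij_betw \<theta> (carrier G) (carrier G)"
    and anti: "\<And>x y. x \<in> carrier G \<Longrightarrow> y \<in> carrier G \<Longrightarrow> \<theta> (x \<otimes> y) = \<theta> y \<otimes> \<theta> x"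
    and conj: "\<And>g. g \<in> carrier G \<Longrightarrow> \<exists>k\<in>K. \<theta> g = k \<otimes> g \<otimes> inv k"
    and \<phi>: "conj_invariant \<phi>" and \<psi>: "conj_invariant \<psi>" and g: "g \<in> carrier G"
  shows "conv_mult \<phi> \<psi> g = conv_mult \<psi> \<phi> g"
proof -
  have \<theta>: "\<theta> x \<in> carrier G" if "x \<in> carrier G" for x using bij that bij_betwE by blast
  have fix_\<theta>: "\<chi> (\<theta> x) = \<chi> x" if "conj_invariant \<chi>" "x \<in> carrier G" for \<chi> x
    using conj[OF that(2)] that unfolding conj_invariant_def by auto
  obtain k where k: "k \<in> K" "\<theta> g = k \<otimes> g \<otimes> inv k" using conj[OF g] by blast
  have kG: "k \<in> carrier G" using k K_carrier by blast
  \<comment> \<open>The product of two invariant functions is again invariant, so it may be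
    evaluated at the conjugate \<open>\<theta> g\<close> of \<open>g\<close>.\<close>
  have "conv_mult \<phi> \<psi> (\<theta> g)
      = (\<Sum>z\<in>carrier G. \<phi> (k \<otimes> z \<otimes> inv k) * \<psi> (inv (k \<otimes> z \<otimes> inv k) \<otimes> \<theta> g))"
    unfolding conv_mult_def
    by (rule sum.reindex_bij_witness[of _ "\<lambda>z. k \<otimes> z \<otimes> inv k" "\<lambda>y. inv k \<otimes> y \<otimes> k"])
      (use kG in \<open>auto simp: m_assoc inv_cancel_left\<close>)
  also have "\<dots> = conv_mult \<phi> \<psi> g"
    unfolding conv_mult_def
  proof (rule sum.cong[OF refl])
    fix z assume z: "z \<in> carrier G"
    have "inv (k \<otimes> z \<otimes> inv k) \<otimes> \<theta> g = k \<otimes> (inv z \<otimes> (inv k \<otimes> (k \<otimes> (g \<otimes> inv k))))"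
      using kG z g by (simp add: k(2) inv_mult_group m_assoc)
    also have "\<dots> = k \<otimes> (inv z \<otimes> g) \<otimes> inv k"
      using kG z g by (simp add: m_assoc inv_cancel_left)
    finally show "\<phi> (k \<otimes> z \<otimes> inv k) * \<psi> (inv (k \<otimes> z \<otimes> inv k) \<otimes> \<theta> g) = \<phi> z * \<psi> (inv z \<otimes> g)"
      using \<phi> \<psi> k(1) z g unfolding conj_invariant_def by simp
  qed
  finally have "conv_mult \<phi> \<psi> g = conv_mult \<phi> \<psi> (\<theta> g)" ..
  also have "\<dots> = (\<Sum>z\<in>carrier G. \<phi> (\<theta> z) * \<psi> (inv (\<theta> z) \<otimes> \<theta> g))"
    unfolding conv_mult_def by (rule sum.reindex_bij_betw[OF bij, symmetric])
  also have "\<dots> = (\<Sum>z\<in>carrier G. \<phi> z * \<psi> (g \<otimes> inv z))"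
  proof (rule sum.cong[OF refl])
    fix z assume z: "z \<in> carrier G"
    \<comment> \<open>Multiplying back by \<open>\<theta> z\<close> gives the quotient directly,
      without computing \<theta> on inverses.\<close>
    have "\<theta> z \<otimes> \<theta> (g \<otimes> inv z) = \<theta> g"
      using anti[of "g \<otimes> inv z" z] z g by (simp add: m_assoc)
    then have "inv (\<theta> z) \<otimes> \<theta> g = \<theta> (g \<otimes> inv z)"
      using inv_cancel_left(1)[of "\<theta> z" "\<theta> (g \<otimes> inv z)"] \<theta> z g by simp
    then show "\<phi> (\<theta> z) * \<psi> (inv (\<theta> z) \<otimes> \<theta> g) = \<phi> z * \<psi> (g \<otimes> inv z)"
      using fix_\<theta>[OF \<phi> z] fix_\<theta>[OF \<psi>, of "g \<otimes> inv z"] z g by simp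
  qed
  also have "\<dots> = conv_mult \<psi> \<phi> g"
    unfolding conv_mult_def
    by (rule sum.reindex_bij_witness[of _ "\<lambda>u. inv u \<otimes> g" "\<lambda>z. g \<otimes> inv z"])
      (use g in \<open>auto simp: inv_mult_group m_assoc inv_cancel_left\<close>)
  finally show ?thesis .
qed

end

theorem strong_gelfand_pair_if_anti_automorphism:
  assumes "group G" "finite (carrier G)" "subgroup K G"
    and "bij_betw \<theta> (carrier G) (carrier G)"
    and "\<And>x y. x \<in> carrier G \<Longrightarrow> y \<in> carrier G \<Longrightarrow> \<theta> (x \<otimes>\<^bsub>G\<^esub> y) = \<theta> y \<otimes>\<^bsub>G\<^esub> \<theta> x"
    and "\<And>g. g \<in> carrier G \<Longrightarrow> \<exists>k\<in>K. \<theta> g = k \<otimes>\<^bsub>G\<^esub> g \<otimes>\<^bsub>G\<^esub> inv\<^bsub>G\<^esub> k"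
  shows "strong_gelfand_pair TYPE('v::ab_group_add) G K"
  unfolding strong_gelfand_pair_def
proof (intro conjI allI impI assms)
  fix s :: "complex \<Rightarrow> 'v \<Rightarrow> 'v" and V \<rho>
  assume "irreducible_complex_rep (G\<lparr>carrier := K\<rparr>) s V \<rho>"
  then interpret irr: irreducible_complex_rep "G\<lparr>carrier := K\<rparr>" s V \<rho> .
  interpret group G by fact
  interpret induced_rep G K s V \<rho>
    by (intro induced_rep.intro induced_rep_axioms.intro assms irr.irreducible_complex_rep_axioms)
  show "multiplicity_free G (ind_scale s) (ind_space G K V \<rho>) (ind_action G)"
  proof (rule ind.multiplicity_free_if_endo_commute[OF finite_G])
    fix S T f
    assume ST: "ind.equivariant_endo S" "ind.equivariant_endo T" and f: "f \<in> ind_space G K V \<rho>"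
    obtain \<phi> where \<phi>: "conj_invariant \<phi>" "\<And>f. f \<in> ind_space G K V \<rho> \<Longrightarrow> S f = convolve \<phi> f"
      using equivariant_endo_is_convolution[OF ST(1)] by blast
    obtain \<psi> where \<psi>: "conj_invariant \<psi>" "\<And>f. f \<in> ind_space G K V \<rho> \<Longrightarrow> T f = convolve \<psi> f"
      using equivariant_endo_is_convolution[OF ST(2)] by blast
    have closed: "S f \<in> ind_space G K V \<rho>" "T f \<in> ind_space G K V \<rho>"
      using ST f ind.linear_endoD(1) unfolding ind.equivariant_endo_def by blast+
    have "S (T f) = convolve (conv_mult \<phi> \<psi>) f"
      using \<phi>(2)[OF closed(2)] \<psi>(2)[OF f] by (simp add: convolve_convolve)
    \<comment> \<open>\<open>convolve\<close> reads its first argument only inside the group, where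
      the two products agree.\<close>
    also have "\<dots> = convolve (conv_mult \<psi> \<phi>) f"
      using conv_mult_commute[OF assms(4-6) \<phi>(1) \<psi>(1)]
      by (auto simp: convolve_def fun_eq_iff intro!: sum.cong)
    also have "\<dots> = T (S f)"
      using \<psi>(2)[OF closed(1)] \<phi>(2)[OF f] by (simp add: convolve_convolve)
    finally show "S (T f) = T (S f)" .
  qed
qed

section \<open>Transposition of monomial matrices\<close>

lemma permutes_funpow_inverse:
  assumes "\<sigma> permutes S"
  shows "(inv' \<sigma> ^^ i) ((\<sigma> ^^ i) x) = x" "(\<sigma> ^^ i) ((inv' \<sigma> ^^ i) x) = x"
  using inv_fn_o_fn_is_id[OF permutes_bij[OF assms], of i]
    fn_o_inv_fn_is_id[OF permutes_bij[OF assms], of i]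
  by (simp_all add: fun_eq_iff)

section \<open>Products of labels around the cycles of a permutation\<close>

context comm_group
begin

lemma finprod_lessThan_Suc:
  "(\<And>i. i < Suc n \<Longrightarrow> f i \<in> carrier G) \<Longrightarrow>
    (\<Otimes>i\<in>{..<Suc n}. f i) = (\<Otimes>i\<in>{..<n}. f i) \<otimes> f n"
  by (subst lessThan_Suc, subst finprod_insert) (auto simp: m_comm)

lemma finprod_lessThan_add:
  fixes m n :: nat
  assumes "\<And>i. i < m + n \<Longrightarrow> f i \<in> carrier G"
  shows "(\<Otimes>i\<in>{..<m + n}. f i) = (\<Otimes>i\<in>{..<m}. f i) \<otimes> (\<Otimes>i\<in>{..<n}. f (m + i))"
  using assms
proof (induction n)
  case (Suc n)
  have "(\<Otimes>i\<in>{..<m + Suc n}. f i) = (\<Otimes>i\<in>{..<m + n}. f i) \<otimes> f (m + n)"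
    using finprod_lessThan_Suc[of "m + n" f] Suc.prems by simp
  moreover have "(\<Otimes>i\<in>{..<Suc n}. f (m + i)) = (\<Otimes>i\<in>{..<n}. f (m + i)) \<otimes> f (m + n)"
    using Suc.prems by (intro finprod_lessThan_Suc) auto
  moreover have "(\<Otimes>i\<in>{..<m}. f i) \<in> carrier G" "(\<Otimes>i\<in>{..<n}. f (m + i)) \<in> carrier G"
    "f (m + n) \<in> carrier G"
    using Suc.prems by (auto intro!: finprod_closed)
  ultimately show ?case using Suc by (simp add: m_assoc)
qed (auto intro!: finprod_closed)

lemma finprod_lessThan_rev:
  fixes n :: nat
  assumes "\<And>i. i < n \<Longrightarrow> f i \<in> carrier G"
  shows "(\<Otimes>i\<in>{..<n}. f (n - Suc i)) = (\<Otimes>i\<in>{..<n}. f i)"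
proof -
  have inj: "inj_on (\<lambda>i. n - Suc i) {..<n}" by (auto simp: inj_on_def)
  have im: "(\<lambda>i. n - Suc i) ` {..<n} = {..<n}"
  proof (intro equalityI subsetI)
    fix i assume "i \<in> {..<n}"
    then show "i \<in> (\<lambda>i. n - Suc i) ` {..<n}" by (intro image_eqI[of _ _ "n - Suc i"]) auto
  qed auto
  show ?thesis
    using finprod_reindex[OF _ inj, of f] assms unfolding im by (auto simp: Pi_def)
qed

text \<open>Advancing the starting point by one step drops one label and appends the same label at
  the end. Here \<open>m\<close> is any period, possibly several turns or none.\<close>

lemma finprod_cycle:
  assumes \<sigma>: "\<sigma> permutes S" and f: "\<And>x. x \<in> S \<Longrightarrow> f x \<in> carrier G" and y: "y \<in> S"
    and per: "(\<sigma> ^^ m) y = y"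
  shows "(\<Otimes>t\<in>{..<m}. f ((\<sigma> ^^ t) ((\<sigma> ^^ k) y))) = (\<Otimes>t\<in>{..<m}. f ((\<sigma> ^^ t) y))"
proof (induction k)
  case (Suc k)
  let ?z = "(\<sigma> ^^ k) y"
  have zS: "(\<sigma> ^^ t) ?z \<in> S" for t
    using permutes_in_funpow_image[OF \<sigma>] y by blast
  have fz: "f ((\<sigma> ^^ t) ?z) \<in> carrier G" for t using f zS by blast
  have perz: "(\<sigma> ^^ m) ?z = ?z"
    using per by (metis add.commute comp_apply funpow_add)
  have "(\<Otimes>t\<in>{..<Suc m}. f ((\<sigma> ^^ t) ?z)) = f ?z \<otimes> (\<Otimes>t\<in>{..<m}. f ((\<sigma> ^^ t) (\<sigma> ?z)))"
    using finprod_lessThan_add[of 1 m "\<lambda>t. f ((\<sigma> ^^ t) ?z)"] fz fz[of 0]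
      finprod_lessThan_Suc[of 0 "\<lambda>t. f ((\<sigma> ^^ t) ?z)"]
    by (simp add: funpow_swap1)
  moreover have "(\<Otimes>t\<in>{..<Suc m}. f ((\<sigma> ^^ t) ?z)) = (\<Otimes>t\<in>{..<m}. f ((\<sigma> ^^ t) ?z)) \<otimes> f ?z"
    using finprod_lessThan_Suc[of m "\<lambda>t. f ((\<sigma> ^^ t) ?z)"] fz by (simp add: perz)
  moreover have "f ((\<sigma> ^^ t) (\<sigma> ?z)) \<in> carrier G" for t
    using fz[of "Suc t"] by (simp add: funpow_swap1)
  ultimately have "(\<Otimes>t\<in>{..<m}. f ((\<sigma> ^^ t) (\<sigma> ?z))) = (\<Otimes>t\<in>{..<m}. f ((\<sigma> ^^ t) ?z))"
    using fz fz[of 0] right_cancel[of "f ?z"] by (simp add: m_comm Pi_def)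
  with Suc show ?case by simp
qed simp

text \<open>Walking backward through a period meets the labels of a forward walk in reverse order,
  which does not matter in an abelian group.\<close>

lemma finprod_cycle_inverse:
  assumes \<sigma>: "\<sigma> permutes S" and f: "\<And>x. x \<in> S \<Longrightarrow> f x \<in> carrier G" and c: "c \<in> S"
    and per: "(\<sigma> ^^ m) c = c"
  shows "(\<Otimes>t\<in>{..<m}. f ((inv' \<sigma> ^^ t) ((\<sigma> ^^ e) c))) = (\<Otimes>t\<in>{..<m}. f ((\<sigma> ^^ t) c))"
proof -
  \<comment> \<open>The backward walk from \<open>\<sigma>^e c\<close> ends, after
    \<open>m - 1\<close> steps, at \<open>\<sigma>^(e + 1) c\<close>; the forward walk has to start
    there.\<close>
  let ?z = "(\<sigma> ^^ Suc e) c"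
  have z: "f ((\<sigma> ^^ t) ?z) \<in> carrier G" for t
    using f permutes_in_funpow_image[OF \<sigma>] c by blast
  have "(\<Otimes>t\<in>{..<m}. f ((inv' \<sigma> ^^ t) ((\<sigma> ^^ e) c)))
      = (\<Otimes>t\<in>{..<m}. f ((\<sigma> ^^ (m - Suc t)) ?z))"
  proof (rule finprod_cong')
    fix t assume "t \<in> {..<m}"
    then have "m + e = t + ((m - Suc t) + Suc e)" by simp
    then have "(\<sigma> ^^ (m + e)) c = (\<sigma> ^^ t) ((\<sigma> ^^ (m - Suc t)) ?z)"
      by (metis comp_apply funpow_add)
    moreover have "(\<sigma> ^^ (m + e)) c = (\<sigma> ^^ e) c"
      using per by (metis add.commute comp_apply funpow_add)
    ultimately have "(inv' \<sigma> ^^ t) ((\<sigma> ^^ e) c) = (\<sigma> ^^ (m - Suc t)) ?z"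
      using permutes_funpow_inverse[OF \<sigma>] by metis
    then show "f ((inv' \<sigma> ^^ t) ((\<sigma> ^^ e) c)) = f ((\<sigma> ^^ (m - Suc t)) ?z)" by simp
  qed (use z in auto)
  also have "\<dots> = (\<Otimes>t\<in>{..<m}. f ((\<sigma> ^^ t) ?z))"
    using finprod_lessThan_rev[of m "\<lambda>t. f ((\<sigma> ^^ t) ?z)"] z by simp
  also have "\<dots> = (\<Otimes>t\<in>{..<m}. f ((\<sigma> ^^ t) c))"
    by (rule finprod_cycle[OF \<sigma> f c per])
  finally show ?thesis .
qed

text \<open>The cocycle equation \<open>a x \<otimes> f (\<tau> x) = f (\<sigma> x) \<otimes> a (\<sigma> x)\<close> is solved by multiplying along
  the cycle from \<open>c\<close>. Since \<open>f\<close> and \<open>f \<circ> \<tau>\<close> have the same product around the whole cycle, the result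
  does not depend on the number of turns.\<close>

lemma cycle_reflection:
  assumes \<sigma>: "\<sigma> permutes S" "finite S" and f: "\<And>x. x \<in> S \<Longrightarrow> f x \<in> carrier G" and c: "c \<in> S"
    and c': "c' \<in> orbit \<sigma> c"
  obtains \<tau> a where
    "\<And>x. x \<in> orbit \<sigma> c \<Longrightarrow> \<tau> x \<in> orbit \<sigma> c \<and> \<tau> (\<tau> x) = x \<and> \<tau> (\<sigma> x) = inv' \<sigma> (\<tau> x)"
    "\<And>x. x \<in> orbit \<sigma> c \<Longrightarrow> a x \<in> carrier G \<and> a x \<otimes> f (\<tau> x) = f (\<sigma> x) \<otimes> a (\<sigma> x)"
    "\<tau> c = c'" "\<tau> c' = c" "a c = \<one>" "a c' = \<one>"
proof -
  note pinv = permutes_funpow_inverse[OF \<sigma>(1)]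
  have perm: "permutation \<sigma>" using \<sigma> by (auto simp: permutation_permutes)
  have orb: "orbit \<sigma> c = {(\<sigma> ^^ i) c | i. True}" by (rule orbit_altdef_permutation[OF perm])
  have orb_inv: "(inv' \<sigma> ^^ i) x \<in> orbit \<sigma> c" if "x \<in> orbit \<sigma> c" for x i
  proof (induction i)
    case (Suc i)
    have "inv' \<sigma> ((inv' \<sigma> ^^ i) x) \<in> orbit (inv' \<sigma>) c"
      using Suc orbit_inv_eq[OF perm, of c] orbit.step[of _ "inv' \<sigma>" c] by simp
    then show ?case using orbit_inv_eq[OF perm, of c] by simp
  qed (use that in simp)
  obtain d where d: "c' = (\<sigma> ^^ d) c" using c' orb by auto
  have orbS: "x \<in> S" if "x \<in> orbit \<sigma> c" for x using permutes_orbit_subset[OF \<sigma>(1) c] that by blast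
  have fs: "f ((\<sigma> ^^ i) c) \<in> carrier G" for i
    using f permutes_in_funpow_image[OF \<sigma>(1) c] by blast
  have fi: "f ((inv' \<sigma> ^^ i) c') \<in> carrier G" for i
    using f orbS orb_inv[OF c'] by blast
  \<comment> \<open>The equation reads
    \<open>a (\<sigma> x) = a x f(\<tau> x) f(\<sigma> x)\<inverse>\<close>, with
    \<open>\<tau> (\<sigma>^i c) = \<sigma>^(-i) c'\<close>. Starting from \<open>a c = 1\<close>,
    the numerators accumulate to \<open>A\<close> and the denominators to \<open>B\<close>, which
    begins at \<open>\<sigma> c\<close> and not at \<open>c\<close>.\<close>
  define A where "A i = (\<Otimes>t\<in>{..<i}. f ((inv' \<sigma> ^^ t) c'))" for i
  define B where "B i = (\<Otimes>t\<in>{..<i}. f ((\<sigma> ^^ Suc t) c))" for i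
  have AB: "A i \<in> carrier G" "B i \<in> carrier G" for i
    unfolding A_def B_def using fs[of "Suc _"] fi by (auto intro!: finprod_closed)
  have shift: "(inv' \<sigma> ^^ i) c' = (inv' \<sigma> ^^ (i + m)) c' \<and> A i \<otimes> inv (B i) = A (i + m) \<otimes> inv (B (i + m))"
    if "(\<sigma> ^^ i) c = (\<sigma> ^^ (i + m)) c" for i m
  proof -
    have per: "(\<sigma> ^^ m) c = c"
      using arg_cong[OF that, of "inv' \<sigma> ^^ i"] by (simp add: pinv funpow_add)
    then have perc': "(\<sigma> ^^ m) c' = c'"
      unfolding d by (metis add.commute comp_apply funpow_add)
    have "(inv' \<sigma> ^^ m) c' = c'" using perc' pinv by metis
    then have 1: "(inv' \<sigma> ^^ i) c' = (inv' \<sigma> ^^ (i + m)) c'" by (simp add: funpow_add)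
    obtain e where e: "(inv' \<sigma> ^^ i) c' = (\<sigma> ^^ e) c" using orb_inv[OF c', of i] orb by auto
    let ?X = "\<Otimes>t\<in>{..<m}. f ((\<sigma> ^^ t) c)"
    have X: "?X \<in> carrier G" using fs by auto
    have "A (i + m) = A i \<otimes> (\<Otimes>t\<in>{..<m}. f ((inv' \<sigma> ^^ (i + t)) c'))"
      unfolding A_def by (rule finprod_lessThan_add) (rule fi)
    also have "(\<Otimes>t\<in>{..<m}. f ((inv' \<sigma> ^^ (i + t)) c'))
        = (\<Otimes>t\<in>{..<m}. f ((inv' \<sigma> ^^ t) ((\<sigma> ^^ e) c)))"
      by (simp add: e[symmetric] funpow_add add.commute[of i])
    also have "\<dots> = ?X" by (rule finprod_cycle_inverse[OF \<sigma>(1) f c per])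
    finally have A: "A (i + m) = A i \<otimes> ?X" .
    have "B (i + m) = B i \<otimes> (\<Otimes>t\<in>{..<m}. f ((\<sigma> ^^ Suc (i + t)) c))"
      unfolding B_def by (rule finprod_lessThan_add) (rule fs)
    also have "(\<Otimes>t\<in>{..<m}. f ((\<sigma> ^^ Suc (i + t)) c))
        = (\<Otimes>t\<in>{..<m}. f ((\<sigma> ^^ t) ((\<sigma> ^^ Suc i) c)))"
    proof -
      have "(\<sigma> ^^ Suc (i + t)) c = (\<sigma> ^^ t) ((\<sigma> ^^ Suc i) c)" for t
        by (metis add.commute add_Suc comp_apply funpow_add)
      then show ?thesis by presburger
    qed
    also have "\<dots> = ?X" by (rule finprod_cycle[OF \<sigma>(1) f c per])
    finally have B: "B (i + m) = B i \<otimes> ?X" .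
    have "A (i + m) \<otimes> inv (B (i + m)) = (A i \<otimes> inv (B i)) \<otimes> (?X \<otimes> inv ?X)"
      unfolding A B using AB X by (simp add: inv_mult m_ac del: r_inv)
    also have "\<dots> = A i \<otimes> inv (B i)" using AB X by simp
    finally show ?thesis using 1 by simp
  qed
  have wd: "(inv' \<sigma> ^^ i) c' = (inv' \<sigma> ^^ j) c' \<and> A i \<otimes> inv (B i) = A j \<otimes> inv (B j)"
    if "(\<sigma> ^^ i) c = (\<sigma> ^^ j) c" for i j
  proof (cases "i \<le> j")
    case True
    show ?thesis using shift[of i "j - i"] that unfolding le_add_diff_inverse[OF True] by blast
  next
    case False
    then have "j \<le> i" by simp
    show ?thesis
      using shift[of j "i - j"] that[symmetric] unfolding le_add_diff_inverse[OF \<open>j \<le> i\<close>] by simp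
  qed
  have arrange: "u \<otimes> ((v \<otimes> w) \<otimes> (y \<otimes> z)) = ((v \<otimes> y) \<otimes> w) \<otimes> (u \<otimes> z)"
    if "u \<in> carrier G" "v \<in> carrier G" "w \<in> carrier G" "y \<in> carrier G" "z \<in> carrier G"
    for u v w y z
    using that by (simp add: m_ac)
  \<comment> \<open>Any index of \<open>x\<close> will do, since \<open>wd\<close> makes the values
    of \<tau> and \<open>a\<close> independent of it.\<close>
  define idx where "idx x = (SOME i. (\<sigma> ^^ i) c = x)" for x
  have idx: "(\<sigma> ^^ idx ((\<sigma> ^^ i) c)) c = (\<sigma> ^^ i) c" for i
    unfolding idx_def by (rule someI) (rule refl)
  define \<tau> where "\<tau> x = (inv' \<sigma> ^^ idx x) c'" for x
  define a where "a x = A (idx x) \<otimes> inv (B (idx x))" for x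
  have \<tau>: "\<tau> ((\<sigma> ^^ i) c) = (inv' \<sigma> ^^ i) c'" and a: "a ((\<sigma> ^^ i) c) = A i \<otimes> inv (B i)" for i
    using wd[OF idx, of i] unfolding \<tau>_def a_def by auto
  show thesis
  proof (rule that[of \<tau> a])
    fix x assume "x \<in> orbit \<sigma> c"
    then obtain i where x: "x = (\<sigma> ^^ i) c" using orb by auto
    have \<sigma>x: "\<sigma> x = (\<sigma> ^^ Suc i) c" by (simp add: x)
    obtain j where j: "(inv' \<sigma> ^^ i) c' = (\<sigma> ^^ j) c" using orb_inv[OF c', of i] orb by auto
    \<comment> \<open>If \<open>\<tau> x = \<sigma>^j c\<close>, then
      \<open>\<tau> (\<tau> x) = \<sigma>^(-j) c'\<close>; so the involution law amounts to
      \<open>c' = \<sigma>^j x\<close>.\<close>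
    have "c' = (\<sigma> ^^ i) ((\<sigma> ^^ j) c)" using j pinv by metis
    also have "\<dots> = (\<sigma> ^^ j) x" unfolding x by (metis add.commute comp_apply funpow_add)
    finally have "(inv' \<sigma> ^^ j) c' = x" using pinv by metis
    then have "\<tau> (\<tau> x) = x" using \<tau>[of j] \<tau>[of i] j x by simp
    moreover have "\<tau> x \<in> orbit \<sigma> c" unfolding x \<tau> by (rule orb_inv[OF c'])
    moreover have "\<tau> (\<sigma> x) = inv' \<sigma> (\<tau> x)"
      using \<tau>[of "Suc i"] \<tau>[of i] by (simp add: x)
    ultimately show "\<tau> x \<in> orbit \<sigma> c \<and> \<tau> (\<tau> x) = x \<and> \<tau> (\<sigma> x) = inv' \<sigma> (\<tau> x)" by blast
    have A: "A (Suc i) = A i \<otimes> f ((inv' \<sigma> ^^ i) c')"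
      unfolding A_def by (rule finprod_lessThan_Suc) (rule fi)
    have B: "B (Suc i) = B i \<otimes> f ((\<sigma> ^^ Suc i) c)"
      unfolding B_def by (rule finprod_lessThan_Suc) (rule fs)
    have carr: "f (\<sigma> x) \<in> carrier G" "f (\<tau> x) \<in> carrier G"
      using fs[of "Suc i"] fi[of i] \<tau>[of i] by (simp_all add: x)
    have ax: "a x = A i \<otimes> inv (B i)" using a by (simp add: x)
    have "a (\<sigma> x) = (A i \<otimes> f (\<tau> x)) \<otimes> inv (B i \<otimes> f (\<sigma> x))"
      using a[of "Suc i"] \<tau>[of i] A B by (simp add: x)
    then have "f (\<sigma> x) \<otimes> a (\<sigma> x) = (a x \<otimes> f (\<tau> x)) \<otimes> (f (\<sigma> x) \<otimes> inv (f (\<sigma> x)))"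
      using AB carr arrange[of "f (\<sigma> x)" "A i" "f (\<tau> x)" "inv (B i)" "inv (f (\<sigma> x))"]
      by (simp add: ax inv_mult del: r_inv)
    also have "\<dots> = a x \<otimes> f (\<tau> x)"
      using AB carr by (simp add: ax)
    finally show "a x \<in> carrier G \<and> a x \<otimes> f (\<tau> x) = f (\<sigma> x) \<otimes> a (\<sigma> x)"
      using AB unfolding x a by simp
  next
    show "\<tau> c = c'" using \<tau>[of 0] by simp
    show "\<tau> c' = c" using \<tau>[of d] pinv by (simp add: d[symmetric]) (simp add: d pinv)
    show "a c = \<one>" using a[of 0] by (simp add: A_def B_def)
    \<comment> \<open>The \<open>d\<close> labels met backward from \<open>c'\<close> are those at
      \<open>\<sigma>^d c, ..., \<sigma> c\<close>, exactly the ones in \<open>B d\<close>. Hence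
      the normalisation at \<open>c\<close> forces the one at \<open>c'\<close>.\<close>
    have "A d = (\<Otimes>t\<in>{..<d}. f ((\<sigma> ^^ Suc (d - Suc t)) c))"
      unfolding A_def
    proof (rule finprod_cong')
      fix t assume "t \<in> {..<d}"
      then have "d = t + Suc (d - Suc t)" by simp
      then have "c' = (\<sigma> ^^ t) ((\<sigma> ^^ Suc (d - Suc t)) c)"
        unfolding d by (metis comp_apply funpow_add)
      then have "(inv' \<sigma> ^^ t) c' = (\<sigma> ^^ Suc (d - Suc t)) c" using pinv by metis
      then show "f ((inv' \<sigma> ^^ t) c') = f ((\<sigma> ^^ Suc (d - Suc t)) c)" by presburger
    qed (use fs[of "Suc _"] in auto)
    also have "\<dots> = B d"
      unfolding B_def by (rule finprod_lessThan_rev) (rule fs)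
    finally show "a c' = \<one>" using a[of d] AB by (simp add: d)
  qed
qed

text \<open>The cycles are reflected independently and glued. Only the pair of exchanged points has
  to be chosen on each cycle so that \<open>{p, q}\<close> is preserved and the labels at
  \<open>p\<close> and \<open>q\<close> are trivial.\<close>

lemma reflection:
  assumes \<sigma>: "\<sigma> permutes S" "finite S" and f: "\<And>x. x \<in> S \<Longrightarrow> f x \<in> carrier G"
    and pq: "p \<in> S" "q \<in> S"
  obtains \<tau> a where "\<tau> permutes S" "\<tau> \<circ> \<tau> = id" "\<tau> \<circ> \<sigma> = inv' \<sigma> \<circ> \<tau>" "\<tau> ` {p, q} = {p, q}"
    "\<And>x. x \<in> S \<Longrightarrow> a x \<in> carrier G" "a p = \<one>" "a q = \<one>"
    "\<And>x. x \<in> S \<Longrightarrow> a x \<otimes> f (\<tau> x) = f (\<sigma> x) \<otimes> a (\<sigma> x)"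
proof -
  have cyc: "cyclic_on \<sigma> (orbit \<sigma> x)" for x by (rule cyclic_on_orbit[OF \<sigma>])
  have self: "x \<in> orbit \<sigma> x" for x
    using \<sigma> permutation_permutes by (intro permutation_self_in_orbit) blast
  \<comment> \<open>All requirements on one cycle are collected in a single predicate, so that one
    choice yields a permutation and a rescaling that fit together.\<close>
  define good where "good Y \<tau> a \<longleftrightarrow> (\<forall>y\<in>Y. \<tau> y \<in> Y \<and> \<tau> (\<tau> y) = y \<and> \<tau> (\<sigma> y) = inv' \<sigma> (\<tau> y)
      \<and> a y \<in> carrier G \<and> a y \<otimes> f (\<tau> y) = f (\<sigma> y) \<otimes> a (\<sigma> y)
      \<and> (y \<in> {p, q} \<longrightarrow> \<tau> y \<in> {p, q} \<and> a y = \<one>))" for Y \<tau> a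
  have "\<exists>\<tau> a. good (orbit \<sigma> x) \<tau> a" if x: "x \<in> S" for x
  proof -
    let ?O = "orbit \<sigma> x"
    \<comment> \<open>If \<open>p\<close> and \<open>q\<close> share the cycle, they are the
      exchanged pair. Otherwise \<open>c = c'\<close> is a fixed point of the reflection: the one of
      \<open>p\<close> and \<open>q\<close> that lies on the cycle, or an arbitrary point.\<close>
    have "\<exists>c c'. c \<in> ?O \<and> c' \<in> ?O \<and> ?O \<inter> {p, q} \<subseteq> {c, c'}
        \<and> (\<forall>y\<in>?O \<inter> {p, q}. c \<in> {p, q} \<and> c' \<in> {p, q})"
    proof -
      consider "p \<in> ?O" "q \<in> ?O" | "p \<in> ?O" "q \<notin> ?O" | "p \<notin> ?O" "q \<in> ?O" | "p \<notin> ?O" "q \<notin> ?O"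
        by blast
      then show ?thesis
      proof cases
        case 1 then show ?thesis by (intro exI[of _ p] exI[of _ q]) auto
      next
        case 2 then show ?thesis by (intro exI[of _ p]) auto
      next
        case 3 then show ?thesis by (intro exI[of _ q]) auto
      next
        case 4 then show ?thesis using self[of x] by (intro exI[of _ x]) auto
      qed
    qed
    then obtain c c' where c: "c \<in> ?O" "c' \<in> ?O" "?O \<inter> {p, q} \<subseteq> {c, c'}"
      "\<And>y. y \<in> ?O \<Longrightarrow> y \<in> {p, q} \<Longrightarrow> c \<in> {p, q} \<and> c' \<in> {p, q}" by blast
    have O: "orbit \<sigma> c = ?O" using orbit_cyclic_eq3[OF cyc c(1)] .
    have c'O: "c' \<in> orbit \<sigma> c" unfolding O by (rule c(2))
    have cS: "c \<in> S" using permutes_orbit_subset[OF \<sigma>(1) x] c(1) by blast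
    obtain \<tau> a where ta:
      "\<And>y. y \<in> ?O \<Longrightarrow> \<tau> y \<in> ?O \<and> \<tau> (\<tau> y) = y \<and> \<tau> (\<sigma> y) = inv' \<sigma> (\<tau> y)"
      "\<And>y. y \<in> ?O \<Longrightarrow> a y \<in> carrier G \<and> a y \<otimes> f (\<tau> y) = f (\<sigma> y) \<otimes> a (\<sigma> y)"
      "\<tau> c = c'" "\<tau> c' = c" "a c = \<one>" "a c' = \<one>"
    proof (rule cycle_reflection[where f = f, OF \<sigma> _ cS c'O, unfolded O], goal_cases)
      case (1 y)
      show ?case using 1(2) by (rule f)
    next
      case (2 \<tau> a)
      show ?case by (rule 2(1)[of \<tau> a]) (use 2(2-) in blast)+
    qed
    have "\<tau> y \<in> {p, q} \<and> a y = \<one>" if "y \<in> ?O" "y \<in> {p, q}" for y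
    proof -
      have "y = c \<or> y = c'" using c(3) that by blast
      then show ?thesis using ta(3-6) c(4)[OF that] by metis
    qed
    then have "good ?O \<tau> a" unfolding good_def using ta(1,2) by blast
    then show ?thesis by blast
  qed
  then have "\<forall>Y\<in>orbit \<sigma> ` S. \<exists>u. good Y (fst u) (snd u)" by force
  \<comment> \<open>The choice is indexed by the orbit as a set and not by a point, so that all
    points of a cycle use the same reflection.\<close>
  then obtain R where R: "\<And>Y. Y \<in> orbit \<sigma> ` S \<Longrightarrow> good Y (fst (R Y)) (snd (R Y))"
    using bchoice by metis
  define \<tau> where "\<tau> x = (if x \<in> S then fst (R (orbit \<sigma> x)) x else x)" for x
  define a where "a x = snd (R (orbit \<sigma> x)) x" for x
  have orb: "orbit \<sigma> y = orbit \<sigma> x" if "y \<in> orbit \<sigma> x" for x y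
    using orbit_cyclic_eq3[OF cyc that] .
  have S: "y \<in> S" if "y \<in> orbit \<sigma> x" "x \<in> S" for x y
    using permutes_orbit_subset[OF \<sigma>(1) that(2)] that(1) by blast
  have \<sigma>Y: "\<sigma> x \<in> orbit \<sigma> x" for x by (rule orbit.base)
  have all: "\<tau> x \<in> S \<and> \<tau> (\<tau> x) = x \<and> \<tau> (\<sigma> x) = inv' \<sigma> (\<tau> x) \<and> a x \<in> carrier G
      \<and> a x \<otimes> f (\<tau> x) = f (\<sigma> x) \<otimes> a (\<sigma> x) \<and> (x \<in> {p, q} \<longrightarrow> \<tau> x \<in> {p, q} \<and> a x = \<one>)"
    if x: "x \<in> S" for x
  proof -
    have g: "good (orbit \<sigma> x) (fst (R (orbit \<sigma> x))) (snd (R (orbit \<sigma> x)))" using R x by blast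
    have \<tau>Y: "\<tau> y = fst (R (orbit \<sigma> x)) y" "a y = snd (R (orbit \<sigma> x)) y" if "y \<in> orbit \<sigma> x" for y
      unfolding \<tau>_def a_def using S[OF that x] orb[OF that] by auto
    define t where "t = fst (R (orbit \<sigma> x))"
    define b where "b = snd (R (orbit \<sigma> x))"
    have tb: "t x \<in> orbit \<sigma> x \<and> t (t x) = x \<and> t (\<sigma> x) = inv' \<sigma> (t x)
      \<and> b x \<in> carrier G \<and> b x \<otimes> f (t x) = f (\<sigma> x) \<otimes> b (\<sigma> x)
      \<and> (x \<in> {p, q} \<longrightarrow> t x \<in> {p, q} \<and> b x = \<one>)"
      using bspec[OF g[unfolded good_def] self[of x]] unfolding t_def b_def .
    note \<tau>Y = \<tau>Y[folded t_def b_def]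
    have tx: "t x \<in> orbit \<sigma> x" using tb by blast
    show ?thesis
      unfolding \<tau>Y[OF self] \<tau>Y(1)[OF tx] \<tau>Y[OF \<sigma>Y] using tb S[OF tx x] by blast
  qed
  show thesis
  proof (rule that[of \<tau> a])
    have "bij_betw \<tau> S S"
      by (rule bij_betw_byWitness[of S \<tau> \<tau>]) (use all in auto)
    then show \<tau>: "\<tau> permutes S" by (rule bij_imp_permutes) (simp add: \<tau>_def)
    show "\<tau> \<circ> \<tau> = id"
    proof
      fix x show "(\<tau> \<circ> \<tau>) x = id x" using all[of x] by (cases "x \<in> S") (auto simp: \<tau>_def)
    qed
    show "\<tau> \<circ> \<sigma> = inv' \<sigma> \<circ> \<tau>"
    proof
      fix x show "(\<tau> \<circ> \<sigma>) x = (inv' \<sigma> \<circ> \<tau>) x"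
        using all[of x] permutes_not_in[OF \<sigma>(1), of x] permutes_not_in[OF \<tau>, of x]
          permutes_not_in[OF permutes_inv[OF \<sigma>(1)], of x]
        by (cases "x \<in> S") auto
    qed
    have "p = \<tau> (\<tau> p)" "q = \<tau> (\<tau> q)" "\<tau> p \<in> {p, q}" "\<tau> q \<in> {p, q}" using all pq by auto
    then show "\<tau> ` {p, q} = {p, q}" by auto
  qed (use all pq in auto)
qed

end

section \<open>The wreath product as a group, its subgroup and the transpose\<close>

lemma wreath_sym_carrier:
  "x \<in> carrier (wreath_sym F n) \<longleftrightarrow>
    fst x \<in> (\<Pi>\<^sub>E i\<in>{1..n}. carrier F) \<and> snd x permutes {1..n}"
  by (auto simp: wreath_sym_def semidirect_product_def sym_group_def mem_Times_iff)

lemma wreath_sym_mult: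
  "(f, \<sigma>) \<otimes>\<^bsub>wreath_sym F n\<^esub> (g, \<tau>) = (\<lambda>i\<in>{1..n}. f i \<otimes>\<^bsub>F\<^esub> g (inv' \<sigma> i), \<sigma> \<circ> \<tau>)"
  by (simp add: wreath_sym_def semidirect_product_def sym_group_def)

lemma wreath_sym_one: "\<one>\<^bsub>wreath_sym F n\<^esub> = (\<lambda>i\<in>{1..n}. \<one>\<^bsub>F\<^esub>, id)"
  by (simp add: wreath_sym_def semidirect_product_def sym_group_def)

text \<open>The inverse has the labels of \<open>f\<close> inverted and transported by the action of
  \<open>inv' \<sigma>\<close>, that is, composed with \<sigma>. The left-inverse form serves the
  group axioms and later identifies the inverse in the subgroup proof.\<close>

lemma wreath_sym_inverse_law:
  assumes "group F" and f: "f \<in> (\<Pi>\<^sub>E i\<in>{1..n}. carrier F)" and \<sigma>: "\<sigma> permutes {1..n}"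
  shows "(\<lambda>i\<in>{1..n}. inv\<^bsub>F\<^esub> f (\<sigma> i), inv' \<sigma>) \<otimes>\<^bsub>wreath_sym F n\<^esub> (f, \<sigma>) = \<one>\<^bsub>wreath_sym F n\<^esub>"
proof -
  interpret F: group F by fact
  have "f (\<sigma> i) \<in> carrier F" if "i \<in> {1..n}" for i
    using f permutes_in_image[OF \<sigma>, of i] that by blast
  then show ?thesis
    unfolding wreath_sym_mult wreath_sym_one
    using permutes_inv_inv[OF \<sigma>] permutes_inv_o(2)[OF \<sigma>]
    by (auto intro!: restrict_ext)
qed

lemma wreath_sym_inverse_carrier:
  assumes "group F" and f: "f \<in> (\<Pi>\<^sub>E i\<in>{1..n}. carrier F)" and \<sigma>: "\<sigma> permutes {1..n}"
  shows "(\<lambda>i\<in>{1..n}. inv\<^bsub>F\<^esub> f (\<sigma> i), inv' \<sigma>) \<in> carrier (wreath_sym F n)"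
proof -
  interpret F: group F by fact
  have "f (\<sigma> i) \<in> carrier F" if "i \<in> {1..n}" for i
    using f permutes_in_image[OF \<sigma>, of i] that by blast
  then show ?thesis
    using permutes_inv[OF \<sigma>] by (auto simp: wreath_sym_carrier)
qed

lemma group_wreath_sym:
  assumes "group F"
  shows "group (wreath_sym F n)"
proof (rule groupI)
  interpret F: group F by fact
  let ?G = "wreath_sym F n"
  fix x assume "x \<in> carrier ?G"
  moreover obtain f \<sigma> where x: "x = (f, \<sigma>)" by fastforce
  ultimately have f: "f \<in> (\<Pi>\<^sub>E i\<in>{1..n}. carrier F)" and \<sigma>: "\<sigma> permutes {1..n}"
    by (auto simp: wreath_sym_carrier)
  have f': "f i \<in> carrier F" if "i \<in> {1..n}" for i using f that by blast
  have \<sigma>': "inv' \<sigma> i \<in> {1..n} \<longleftrightarrow> i \<in> {1..n}" for i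
    by (rule permutes_in_image[OF permutes_inv[OF \<sigma>]])
  show "\<one>\<^bsub>?G\<^esub> \<otimes>\<^bsub>?G\<^esub> x = x"
    unfolding x wreath_sym_one wreath_sym_mult using f
    by (auto intro!: ext simp: PiE_iff extensional_def)
  show "\<exists>y\<in>carrier ?G. y \<otimes>\<^bsub>?G\<^esub> x = \<one>\<^bsub>?G\<^esub>"
    unfolding x
    using wreath_sym_inverse_law[OF assms f \<sigma>] wreath_sym_inverse_carrier[OF assms f \<sigma>] by blast
  fix y assume "y \<in> carrier ?G"
  moreover obtain g \<tau> where y: "y = (g, \<tau>)" by fastforce
  ultimately have g: "g \<in> (\<Pi>\<^sub>E i\<in>{1..n}. carrier F)" and \<tau>: "\<tau> permutes {1..n}"
    by (auto simp: wreath_sym_carrier)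
  have g': "g i \<in> carrier F" if "i \<in> {1..n}" for i using g that by blast
  have \<tau>': "inv' \<tau> i \<in> {1..n} \<longleftrightarrow> i \<in> {1..n}" for i
    by (rule permutes_in_image[OF permutes_inv[OF \<tau>]])
  show "x \<otimes>\<^bsub>?G\<^esub> y \<in> carrier ?G"
    unfolding x y wreath_sym_mult wreath_sym_carrier
    using f' g' \<sigma>' permutes_compose[OF \<tau> \<sigma>] by auto
  fix z assume "z \<in> carrier ?G"
  moreover obtain h \<upsilon> where z: "z = (h, \<upsilon>)" by fastforce
  ultimately have h: "h \<in> (\<Pi>\<^sub>E i\<in>{1..n}. carrier F)"
    by (auto simp: wreath_sym_carrier)
  have h': "h i \<in> carrier F" if "i \<in> {1..n}" for i using h that by blast
  \<comment> \<open>Acting through the inverse permutation gives a left action, which is what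
    associativity requires.\<close>
  have "inv' (\<sigma> \<circ> \<tau>) = inv' \<tau> \<circ> inv' \<sigma>"
    by (rule o_inv_distrib[OF permutes_bij[OF \<sigma>] permutes_bij[OF \<tau>]])
  then show "x \<otimes>\<^bsub>?G\<^esub> y \<otimes>\<^bsub>?G\<^esub> z = x \<otimes>\<^bsub>?G\<^esub> (y \<otimes>\<^bsub>?G\<^esub> z)"
    unfolding x y z wreath_sym_mult
    using f' g' h' \<sigma>' \<tau>' by (auto intro!: restrict_ext simp: F.m_assoc comp_assoc)
next
  interpret F: group F by fact
  show "\<one>\<^bsub>wreath_sym F n\<^esub> \<in> carrier (wreath_sym F n)"
    unfolding wreath_sym_one wreath_sym_carrier by (auto simp: permutes_id)
qed

lemma finite_wreath_sym:
  assumes "finite (carrier F)"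
  shows "finite (carrier (wreath_sym F n))"
proof (rule finite_subset)
  show "carrier (wreath_sym F n) \<subseteq> (\<Pi>\<^sub>E i\<in>{1..n}. carrier F) \<times> {\<sigma>. \<sigma> permutes {1..n}}"
    by (rule subsetI) (simp add: wreath_sym_carrier mem_Times_iff)
qed (use assms in \<open>auto intro: finite_PiE finite_permutations\<close>)

lemma subgroup_wreath_sym_times_S2:
  assumes "group F" and n: "n \<ge> 2"
  shows "subgroup (wreath_sym_times_S2 F n) (wreath_sym F n)"
proof -
  interpret F: group F by fact
  interpret G: group "wreath_sym F n" by (rule group_wreath_sym[OF assms(1)])
  let ?G = "wreath_sym F n" and ?M = "{n - 1, n}" and ?K = "wreath_sym_times_S2 F n"
  have M: "?M \<subseteq> {1..n}" using n by auto
  \<comment> \<open>The two label conditions are restated as one condition on the set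
    \<open>?M\<close>, so that they can be carried along by permutations preserving
    \<open>?M\<close>.\<close>
  have K: "(f, \<sigma>) \<in> ?K \<longleftrightarrow> (f, \<sigma>) \<in> carrier ?G \<and> \<sigma> ` ?M = ?M \<and> (\<forall>i\<in>?M. f i = \<one>\<^bsub>F\<^esub>)" for f \<sigma>
    by (auto simp: wreath_sym_times_S2_def)
  have inv_M: "inv' \<sigma> ` ?M = ?M" if "\<sigma> permutes {1..n}" "\<sigma> ` ?M = ?M" for \<sigma>
  proof -
    have "inv' \<sigma> ` ?M = inv' \<sigma> ` \<sigma> ` ?M" by (simp only: that(2))
    also have "\<dots> = ?M" by (simp only: image_comp permutes_inv_o(2)[OF that(1)] image_id id_apply)
    finally show ?thesis .
  qed
  show ?thesis
  proof (rule G.subgroupI)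
    show "?K \<subseteq> carrier ?G" by (auto simp: wreath_sym_times_S2_def)
    have "\<one>\<^bsub>?G\<^esub> \<in> ?K"
      using G.one_closed M unfolding wreath_sym_one K by auto
    then show "?K \<noteq> {}" by blast
    fix x assume "x \<in> ?K"
    moreover obtain f \<sigma> where x: "x = (f, \<sigma>)" by fastforce
    ultimately have xK: "(f, \<sigma>) \<in> ?K" by simp
    then have f: "f \<in> (\<Pi>\<^sub>E i\<in>{1..n}. carrier F)" and \<sigma>: "\<sigma> permutes {1..n}"
      and \<sigma>M: "\<sigma> ` ?M = ?M" and fM: "\<And>i. i \<in> ?M \<Longrightarrow> f i = \<one>\<^bsub>F\<^esub>"
      unfolding K wreath_sym_carrier by auto
    note inv_law = wreath_sym_inverse_law[OF assms(1) f \<sigma>]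
      and inv_carrier = wreath_sym_inverse_carrier[OF assms(1) f \<sigma>]
    have inv_x: "inv\<^bsub>?G\<^esub> x = (\<lambda>i\<in>{1..n}. inv\<^bsub>F\<^esub> f (\<sigma> i), inv' \<sigma>)"
      using xK inv_carrier unfolding x K by (intro G.inv_equality[OF inv_law]) auto
    have "(\<lambda>i\<in>{1..n}. inv\<^bsub>F\<^esub> f (\<sigma> i)) i = \<one>\<^bsub>F\<^esub>" if "i \<in> ?M" for i
    proof -
      have "\<sigma> i \<in> ?M" using \<sigma>M that by blast
      then have "f (\<sigma> i) = \<one>\<^bsub>F\<^esub>" by (rule fM)
      moreover have "i \<in> {1..n}" using M that by blast
      ultimately show ?thesis by simp
    qed
    then show "inv\<^bsub>?G\<^esub> x \<in> ?K"
      unfolding inv_x K using inv_carrier inv_M[OF \<sigma> \<sigma>M] by blast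
    fix y assume "y \<in> ?K"
    moreover obtain g \<tau> where y: "y = (g, \<tau>)" by fastforce
    ultimately have yK: "(g, \<tau>) \<in> ?K" by simp
    then have \<tau>M: "\<tau> ` ?M = ?M" and gM: "\<And>i. i \<in> ?M \<Longrightarrow> g i = \<one>\<^bsub>F\<^esub>"
      unfolding K by auto
    have "(\<lambda>i\<in>{1..n}. f i \<otimes>\<^bsub>F\<^esub> g (inv' \<sigma> i)) i = \<one>\<^bsub>F\<^esub>" if "i \<in> ?M" for i
    proof -
      have "inv' \<sigma> i \<in> ?M" using inv_M[OF \<sigma> \<sigma>M] that by blast
      then have "g (inv' \<sigma> i) = \<one>\<^bsub>F\<^esub>" by (rule gM)
      moreover have "i \<in> {1..n}" using M that by blast
      ultimately show ?thesis using fM[OF that] by simp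
    qed
    moreover have "(\<sigma> \<circ> \<tau>) ` ?M = ?M" by (simp only: image_comp[symmetric] \<sigma>M \<tau>M)
    moreover have "(f, \<sigma>) \<otimes>\<^bsub>?G\<^esub> (g, \<tau>) \<in> carrier ?G"
      using xK yK by (intro G.m_closed) (auto simp only: K)
    ultimately show "x \<otimes>\<^bsub>?G\<^esub> y \<in> ?K"
      unfolding x y wreath_sym_mult K by blast
  qed
qed

text \<open>Regarding \<open>(f, \<sigma>)\<close> as the monomial matrix with entry \<open>f i\<close> at \<open>(i, inv' \<sigma> i)\<close>, this is
  transposition.\<close>

definition wreath_transpose :: "(nat \<Rightarrow> 'a) \<times> (nat \<Rightarrow> nat) \<Rightarrow> (nat \<Rightarrow> 'a) \<times> (nat \<Rightarrow> nat)" where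
  "wreath_transpose x = (fst x \<circ> snd x, inv' (snd x))"

lemma wreath_transpose_closed:
  assumes "x \<in> carrier (wreath_sym F n)"
  shows "wreath_transpose x \<in> carrier (wreath_sym F n)"
proof -
  have f: "fst x \<in> (\<Pi>\<^sub>E i\<in>{1..n}. carrier F)" and \<sigma>: "snd x permutes {1..n}"
    using assms by (auto simp: wreath_sym_carrier)
  have "fst x (snd x i) \<in> carrier F" if "i \<in> {1..n}" for i
    using f permutes_in_image[OF \<sigma>, of i] that by blast
  \<comment> \<open>As \<sigma> fixes every point outside \<open>{1..n}\<close>, composition with it
    preserves the default value \<open>undefined\<close> there.\<close>
  moreover have "fst x (snd x i) = undefined" if "i \<notin> {1..n}" for i
    using f permutes_not_in[OF \<sigma> that] that by (auto simp: PiE_iff extensional_def)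
  ultimately show ?thesis
    using permutes_inv[OF \<sigma>] by (auto simp: wreath_sym_carrier wreath_transpose_def PiE_iff extensional_def)
qed

lemma wreath_transpose_bij:
  "bij_betw wreath_transpose (carrier (wreath_sym F n)) (carrier (wreath_sym F n))"
proof -
  have "wreath_transpose (wreath_transpose x) = x" if "x \<in> carrier (wreath_sym F n)" for x
    using that permutes_inv_inv[of "snd x" "{1..n}"] permutes_inv_o(1)[of "snd x" "{1..n}"]
    by (auto simp: wreath_sym_carrier wreath_transpose_def comp_assoc prod_eq_iff)
  then show ?thesis
    by (intro bij_betw_byWitness[of _ wreath_transpose]) (auto intro: wreath_transpose_closed)
qed

lemma wreath_transpose_mult:
  assumes "comm_group F" and x: "x \<in> carrier (wreath_sym F n)" and y: "y \<in> carrier (wreath_sym F n)"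
  shows "wreath_transpose (x \<otimes>\<^bsub>wreath_sym F n\<^esub> y)
    = wreath_transpose y \<otimes>\<^bsub>wreath_sym F n\<^esub> wreath_transpose x"
proof -
  interpret F: comm_group F by fact
  obtain f \<sigma> g \<tau> where xy: "x = (f, \<sigma>)" "y = (g, \<tau>)" by fastforce
  have f: "f \<in> (\<Pi>\<^sub>E i\<in>{1..n}. carrier F)" and \<sigma>: "\<sigma> permutes {1..n}"
    and g: "g \<in> (\<Pi>\<^sub>E i\<in>{1..n}. carrier F)" and \<tau>: "\<tau> permutes {1..n}"
    using x y by (auto simp: xy wreath_sym_carrier)
  have "((\<lambda>i\<in>{1..n}. f i \<otimes>\<^bsub>F\<^esub> g (inv' \<sigma> i)) \<circ> (\<sigma> \<circ> \<tau>)) i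
      = (\<lambda>i\<in>{1..n}. (g \<circ> \<tau>) i \<otimes>\<^bsub>F\<^esub> (f \<circ> \<sigma>) (inv' (inv' \<tau>) i)) i" for i
  proof (cases "i \<in> {1..n}")
    case True
    then have "\<tau> i \<in> {1..n}" "\<sigma> (\<tau> i) \<in> {1..n}"
      using permutes_in_image[OF \<sigma>] permutes_in_image[OF \<tau>] by blast+
    moreover from this have "g (\<tau> i) \<in> carrier F" "f (\<sigma> (\<tau> i)) \<in> carrier F" using f g by blast+
    \<comment> \<open>Both sides multiply the labels \<open>f (\<sigma> (\<tau> i))\<close> and
      \<open>g (\<tau> i)\<close>, in opposite orders.\<close>
    ultimately show ?thesis
      using True permutes_inverses(2)[OF \<sigma>] permutes_inv_inv[OF \<tau>] by (simp add: F.m_comm)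
  next
    case False
    then have "\<sigma> (\<tau> i) \<notin> {1..n}"
      using permutes_in_image[OF \<sigma>] permutes_in_image[OF \<tau>] by blast
    with False show ?thesis by auto
  qed
  then show ?thesis
    using o_inv_distrib[OF permutes_bij[OF \<sigma>] permutes_bij[OF \<tau>]]
    unfolding xy wreath_sym_mult wreath_transpose_def fst_conv snd_conv by blast
qed

text \<open>For \<open>k = (a, \<tau>)\<close> the identity to be shown is that \<open>k\<close>
  times \<open>x\<close> equals the transpose of \<open>x\<close> times \<open>k\<close>. When
  \<tau> is an involution, the permutation parts agree by
  \<open>\<tau> \<circ> \<sigma> = inv' \<sigma> \<circ> \<tau>\<close> and the labels by \<open>a i
  \<otimes> f (\<tau> i) = f (\<sigma> i) \<otimes> a (\<sigma> i)\<close>; this is the origin of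
  the two equations in \<open>reflection\<close>.\<close>

lemma wreath_transpose_conjugate:
  assumes "comm_group F" and n: "n \<ge> 2" and x: "x \<in> carrier (wreath_sym F n)"
  shows "\<exists>k\<in>wreath_sym_times_S2 F n.
    wreath_transpose x = k \<otimes>\<^bsub>wreath_sym F n\<^esub> x \<otimes>\<^bsub>wreath_sym F n\<^esub> inv\<^bsub>wreath_sym F n\<^esub> k"
proof -
  interpret F: comm_group F by fact
  interpret G: group "wreath_sym F n" by (rule group_wreath_sym) unfold_locales
  obtain f \<sigma> where xfs: "x = (f, \<sigma>)" by fastforce
  have f: "f \<in> (\<Pi>\<^sub>E i\<in>{1..n}. carrier F)" and \<sigma>: "\<sigma> permutes {1..n}"
    using x by (auto simp: xfs wreath_sym_carrier)
  have M: "n - 1 \<in> {1..n}" "n \<in> {1..n}" using n by auto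
  have f': "f i \<in> carrier F" if "i \<in> {1..n}" for i using f that by blast
  obtain \<tau> a where \<tau>: "\<tau> permutes {1..n}" "\<tau> \<circ> \<tau> = id" "\<tau> \<circ> \<sigma> = inv' \<sigma> \<circ> \<tau>"
      "\<tau> ` {n - 1, n} = {n - 1, n}"
    and a: "\<And>i. i \<in> {1..n} \<Longrightarrow> a i \<in> carrier F" "a (n - 1) = \<one>\<^bsub>F\<^esub>" "a n = \<one>\<^bsub>F\<^esub>"
      "\<And>i. i \<in> {1..n} \<Longrightarrow> a i \<otimes>\<^bsub>F\<^esub> f (\<tau> i) = f (\<sigma> i) \<otimes>\<^bsub>F\<^esub> a (\<sigma> i)"
  proof (rule F.reflection[where f = f, OF \<sigma> finite_atLeastAtMost _ M], goal_cases)
    case (1 i)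
    show ?case using 1(2) by (rule f')
  next
    case (2 \<tau> a)
    show ?case by (rule 2(1)[of \<tau> a]) (use 2(2-) in blast)+
  qed
  define k where "k = (restrict a {1..n}, \<tau>)"
  have kG: "k \<in> carrier (wreath_sym F n)" using \<tau>(1) a(1) by (simp add: k_def wreath_sym_carrier)
  then have kK: "k \<in> wreath_sym_times_S2 F n"
    using \<tau>(4) a(2,3) M by (simp add: k_def wreath_sym_times_S2_def)
  have "inv' \<tau> = \<tau>" using \<tau>(2) by (rule inv_unique_comp) (rule \<tau>(2))
  then have "k \<otimes>\<^bsub>wreath_sym F n\<^esub> x = wreath_transpose x \<otimes>\<^bsub>wreath_sym F n\<^esub> k"
    unfolding k_def xfs wreath_transpose_def fst_conv snd_conv wreath_sym_mult
    using a(4) \<tau>(3) permutes_inv_inv[OF \<sigma>] permutes_in_image[OF \<sigma>]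
    by (auto intro!: restrict_ext)
  then have "k \<otimes>\<^bsub>wreath_sym F n\<^esub> x \<otimes>\<^bsub>wreath_sym F n\<^esub> inv\<^bsub>wreath_sym F n\<^esub> k = wreath_transpose x"
    using kG x wreath_transpose_closed[OF x] by (simp add: G.m_assoc)
  with kK show ?thesis by metis
qed

theorem proposition4p5:
  fixes F :: "('a, 'm) monoid_scheme" and n :: nat
  assumes "comm_group F" and "finite (carrier F)" and "n \<ge> 2"
  shows "strong_gelfand_pair TYPE('v::ab_group_add) (wreath_sym F n) (wreath_sym_times_S2 F n)"
proof -
  interpret F: comm_group F by fact
  show ?thesis
    by (rule strong_gelfand_pair_if_anti_automorphism[where \<theta> = wreath_transpose,
          OF group_wreath_sym[OF F.is_group] finite_wreath_sym[OF assms(2)]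
            subgroup_wreath_sym_times_S2[OF F.is_group assms(3)] wreath_transpose_bij
            wreath_transpose_mult[OF assms(1)] wreath_transpose_conjugate[OF assms(1,3)]])
qed

end
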